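(* Let $(G,E)$ be a contracting self-similar groupoid action with nucleus $\mathcal N$. Then for any $\mu\in\partial E=E^\infty$ and every sufficiently long prefix $\alpha$ of $\mu$ we have $$\overline X(\mu)=\{\mu\}\cup\{[\alpha,n,\alpha;\mu]:n\in\mathcal N\text{ and }(\alpha,n)\text{ is a singular decomposition of }\mu\}.$$ In particular, $|\overline X(\mu)|\le|\mathcal N|$. Thus $\widetilde{\mathcal G}(G,E)$ and $\mathcal G(G,E)$ are finitely non-Hausdorff.
   Context: A directed graph $E=(E^0,E^1,r,s)$ has vertices $E^0$, edges $E^1$, and maps $r,s:E^1\to E^0$. For $n\ge1$, $E^n$ is the set of paths $\mu=\mu_1\cdots\mu_n$ ($\mu_i\in E^1$, $s(\mu_i)=r(\mu_{i+1})$), $r(\mu)=r(\mu_1)$, $s(\mu)=s(\mu_n)$, $|\mu|=n$; vertices are paths of length $0$ with $r(v)=s(v)=v$; $E^*=\bigcup_{n\ge0}E^n$; $E^\infty$ is the set of infinite paths; $vE^n,vE^*$ denote paths with range $v$. $\alpha$ extends $\beta$ ($\beta$ is a prefix of $\alpha$) if $\alpha=\beta\beta'$. A vertex $v$ is a source if $vE^1=\emptyset$, and singular if $vE^1$ is empty or infinite. $(G,E)$ is a self-similar action if $G$ is a discrete groupoid with $G^0=E^0$, equipped with a left action $(g,e)\mapsto ge$ on $E^1$ (defined when $s(g)=r(e)$, with $r(ge)=r(g)$, $(hg)e=h(ge)$, $r(e)e=e$) and a map $(g,e)\mapsto g|_e\in G$ with $(hg)|_e=h|_{ge}\,g|_e$,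 $s(g|_e)=s(e)$, $r(g|_e)=s(ge)$. It extends to paths by $g\,s(g)=r(g)$, $g|_{s(g)}=g$, $g(e\mu)=(ge)(g|_e\mu)$, $g|_{e\mu}=(g|_e)|_\mu$, and to infinite paths by $g(\mu_1\mu_2\cdots)=(g\mu_1)(g|_{\mu_1}\mu_2)(g|_{\mu_1\mu_2}\mu_3)\cdots$. It is contracting if $E$ is a finite graph without sources and there is a finite set $\mathcal N\subseteq G$ such that for every $g\in G$ there is $n\ge0$ with $g|_\mu\in\mathcal N$ for all $\mu\in s(g)E^*$ with $|\mu|\ge n$; the smallest such $\mathcal N$ is the nucleus. A finite path $\mu\in s(g)E^*$ is strongly $g$-fixed if $g\mu=\mu$ and $g|_\mu=s(\mu)$; an infinite path is strongly $g$-fixed if it has a strongly $g$-fixed finite prefix. $E^{\le\infty}=E^*\cup E^\infty$; $Z(\alpha)$ is the set of elements of $E^{\le\infty}$ with prefix $\alpha$; the sets $Z(\alpha)\setminus\bigcup_{\beta\in F}Z(\alpha\beta)$ ($F\subseteq s(\alpha)E^*$ finite) form a basis of the topology. $\partial E=E^\infty\cup\{\mu\in E^*:s(\mu)\text{ singular}\}$ (equal to $E^\infty$ here). $\widetilde{\mathcal G}(G,E)$ consists of classes $[\alpha,g,\beta;\xi]$, where $\alpha,\beta\in E^*$, $g\in G$, $r(g)=s(\alpha)$, $s(g)=s(\beta)$, $\xi\in Z(\beta)$, and $[\alpha,g,\beta;\xi]=[\gamma,h,\delta;\eta]$ iff $\xi=\eta$ and there are $\beta',\delta'\in E^*$ with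 $\beta\beta'=\delta\delta'$ a prefix of $\xi$, $\alpha(g\beta')=\gamma(h\delta')$ and $g|_{\beta'}=h|_{\delta'}$. The source of $[\alpha,g,\beta;\beta\xi]$ is $\beta\xi$, its range is $\alpha(g\xi)$; $\xi\in E^{\le\infty}$ is identified with the unit $[r(\xi),r(\xi),r(\xi);\xi]$; basic open sets are $\{[\alpha,g,\beta;\xi]:\xi\in V\}$, $V\subseteq Z(\beta)$ open. $\mathcal G(G,E)$ is its restriction to $\partial E$. For $\mu\in\partial E$, $\overline X(\mu)$ is the set of elements of $\mathcal G(G,E)$ with range and source $\mu$ that lie in the closure of $\partial E$ in $\mathcal G(G,E)$. A topological space is finitely non-Hausdorff if each of its points $y$ has only finitely many points that cannot be separated from $y$ by disjoint open sets. A singular decomposition of $\mu\in E^\infty$ is a pair $(\alpha,g)$, $\alpha\in E^*$, $g\in G$, $s(\alpha)=r(g)$, such that $\mu=\alpha\xi$, $\xi$ is not strongly $g$-fixed, and every finite prefix of $\xi$ has a strongly $g$-fixed extension in $E^*$. *)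

theory Defs
  imports
    "Graph_Theory.Digraph"
    "HOL-Library.Stream"
    "HOL-Analysis.Function_Topology"
begin

section \<open>Path spaces of directed graphs\<close>

text \<open>
  For an edge \<open>e\<close> of a digraph \<open>E\<close> we read \<^term>\<open>tail E e\<close> as the source \<open>s(e)\<close> and
  \<^term>\<open>head E e\<close> as the range \<open>r(e)\<close>, so that \<^term>\<open>in_arcs E v\<close> is \<open>vE\<^sup>1\<close>. Consecutive edges
  \<open>e f\<close> of a path satisfy \<open>s(e) = r(f)\<close>, the reverse of the convention for walks in \<open>Graph_Theory\<close>.

  A finite path is a pair \<open>(v, es)\<close> of its range \<open>v\<close> and its list of edges; the path of length 0
  at a vertex \<open>v\<close> is \<open>(v, [])\<close>.
\<close>

type_synonym ('v, 'e) fin_path = "'v \<times> 'e list"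

definition fin_paths :: "('v, 'e) pre_digraph \<Rightarrow> ('v, 'e) fin_path set" where
  "fin_paths E = {(v, es). v \<in> verts E \<and> set es \<subseteq> arcs E \<and> (es \<noteq> [] \<longrightarrow> head E (hd es) = v)
     \<and> successively (\<lambda>e f. tail E e = head E f) es}"

definition inf_paths :: "('v, 'e) pre_digraph \<Rightarrow> 'e stream set" where
  "inf_paths E = {x. sset x \<subseteq> arcs E \<and> (\<forall>i. tail E (x !! i) = head E (x !! Suc i))}"

abbreviation fin_rng :: "('v, 'e) fin_path \<Rightarrow> 'v" where
  "fin_rng \<equiv> fst"

definition fin_src :: "('v, 'e) pre_digraph \<Rightarrow> ('v, 'e) fin_path \<Rightarrow> 'v" where
  "fin_src E p = (if snd p = [] then fst p else tail E (last (snd p)))"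

definition path_length :: "('v, 'e) fin_path \<Rightarrow> nat" where
  "path_length p = length (snd p)"

datatype ('v, 'e) ext_path = FinPath "('v, 'e) fin_path" | InfPath "'e stream"

definition ext_paths :: "('v, 'e) pre_digraph \<Rightarrow> ('v, 'e) ext_path set" where
  "ext_paths E = FinPath ` fin_paths E \<union> InfPath ` inf_paths E"

primrec ext_rng :: "('v, 'e) pre_digraph \<Rightarrow> ('v, 'e) ext_path \<Rightarrow> 'v" where
  "ext_rng E (FinPath p) = fin_rng p"
| "ext_rng E (InfPath x) = head E (shd x)"

text \<open>The concatenations below are meaningful when the source of the first path is the range of
  the second; this is required wherever they are used.\<close>

definition fin_append :: "('v, 'e) fin_path \<Rightarrow> ('v, 'e) fin_path \<Rightarrow> ('v, 'e) fin_path" where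
  "fin_append p q = (fst p, snd p @ snd q)"

primrec ext_append :: "('v, 'e) fin_path \<Rightarrow> ('v, 'e) ext_path \<Rightarrow> ('v, 'e) ext_path" where
  "ext_append p (FinPath q) = FinPath (fin_append p q)"
| "ext_append p (InfPath x) = InfPath (snd p @- x)"

definition cylinder :: "('v, 'e) pre_digraph \<Rightarrow> ('v, 'e) fin_path \<Rightarrow> ('v, 'e) ext_path set" where
  "cylinder E p = {ext_append p x | x. x \<in> ext_paths E \<and> ext_rng E x = fin_src E p}"

definition is_prefix :: "('v, 'e) pre_digraph \<Rightarrow> ('v, 'e) fin_path \<Rightarrow> ('v, 'e) ext_path \<Rightarrow> bool" where
  "is_prefix E p x \<longleftrightarrow> p \<in> fin_paths E \<and> x \<in> cylinder E p"

text \<open>The generating families of this topology and of the topology on germs below are closed under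
  finite intersections up to unions, so they are bases of the topologies they generate.\<close>

definition path_topology :: "('v, 'e) pre_digraph \<Rightarrow> ('v, 'e) ext_path topology" where
  "path_topology E = topology_generated_by
     {cylinder E p - (\<Union>q\<in>F. cylinder E (fin_append p q)) | p F.
        p \<in> fin_paths E \<and> finite F \<and> F \<subseteq> {q \<in> fin_paths E. fin_rng q = fin_src E p}}"

definition singular_vertex :: "('v, 'e) pre_digraph \<Rightarrow> 'v \<Rightarrow> bool" where
  "singular_vertex E v \<longleftrightarrow> in_arcs E v = {} \<or> infinite (in_arcs E v)"

definition boundary :: "('v, 'e) pre_digraph \<Rightarrow> ('v, 'e) ext_path set" where
  "boundary E = InfPath ` inf_paths E
     \<union> FinPath ` {p \<in> fin_paths E. singular_vertex E (fin_src E p)}"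


section \<open>Self-similar groupoid actions\<close>

record 'g groupoid_struct =
  elems :: "'g set"
  gsrc :: "'g \<Rightarrow> 'g"
  grng :: "'g \<Rightarrow> 'g"
  gmult :: "'g \<Rightarrow> 'g \<Rightarrow> 'g"

text \<open>Units are elements of the groupoid, and \<open>gmult g h\<close> is the product \<open>gh\<close>, defined when
  \<open>s(g) = r(h)\<close>.\<close>

locale groupoid =
  fixes G :: "'g groupoid_struct"
  assumes src_closed: "g \<in> elems G \<Longrightarrow> gsrc G g \<in> elems G"
    and rng_closed: "g \<in> elems G \<Longrightarrow> grng G g \<in> elems G"
    and src_src: "g \<in> elems G \<Longrightarrow> gsrc G (gsrc G g) = gsrc G g"
    and rng_src: "g \<in> elems G \<Longrightarrow> grng G (gsrc G g) = gsrc G g"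
    and src_rng: "g \<in> elems G \<Longrightarrow> gsrc G (grng G g) = grng G g"
    and rng_rng: "g \<in> elems G \<Longrightarrow> grng G (grng G g) = grng G g"
    and mult_closed: "\<lbrakk>g \<in> elems G; h \<in> elems G; gsrc G g = grng G h\<rbrakk> \<Longrightarrow> gmult G g h \<in> elems G"
    and src_mult: "\<lbrakk>g \<in> elems G; h \<in> elems G; gsrc G g = grng G h\<rbrakk>
          \<Longrightarrow> gsrc G (gmult G g h) = gsrc G h"
    and rng_mult: "\<lbrakk>g \<in> elems G; h \<in> elems G; gsrc G g = grng G h\<rbrakk>
          \<Longrightarrow> grng G (gmult G g h) = grng G g"
    and assoc: "\<lbrakk>g \<in> elems G; h \<in> elems G; k \<in> elems G; gsrc G g = grng G h; gsrc G h = grng G k\<rbrakk>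
          \<Longrightarrow> gmult G (gmult G g h) k = gmult G g (gmult G h k)"
    and mult_src: "g \<in> elems G \<Longrightarrow> gmult G g (gsrc G g) = g"
    and rng_mult_id: "g \<in> elems G \<Longrightarrow> gmult G (grng G g) g = g"
    and inverse_exists: "g \<in> elems G \<Longrightarrow>
          \<exists>h\<in>elems G. gsrc G h = grng G g \<and> grng G h = gsrc G g
             \<and> gmult G g h = grng G g \<and> gmult G h g = gsrc G g"

definition units :: "'g groupoid_struct \<Rightarrow> 'g set" where
  "units G = gsrc G ` elems G"

text \<open>The vertices of the graph are themselves elements of the groupoid. For \<open>s(g) = r(e)\<close>,
  \<open>act S g e\<close> is the edge \<open>ge\<close> and \<open>restr S g e\<close> is \<open>g|\<^sub>e\<close>.\<close>

record ('g, 'e) action_struct =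
  gpd :: "'g groupoid_struct"
  graph :: "('g, 'e) pre_digraph"
  act :: "'g \<Rightarrow> 'e \<Rightarrow> 'e"
  restr :: "'g \<Rightarrow> 'e \<Rightarrow> 'g"

locale self_similar_action =
  fixes S :: "('g, 'e) action_struct"
  assumes groupoid: "groupoid (gpd S)"
    and graph: "wf_digraph (graph S)"
    and units: "units (gpd S) = verts (graph S)"
    and act_closed: "\<lbrakk>g \<in> elems (gpd S); e \<in> arcs (graph S); gsrc (gpd S) g = head (graph S) e\<rbrakk>
          \<Longrightarrow> act S g e \<in> arcs (graph S)"
    and restr_closed: "\<lbrakk>g \<in> elems (gpd S); e \<in> arcs (graph S); gsrc (gpd S) g = head (graph S) e\<rbrakk>
          \<Longrightarrow> restr S g e \<in> elems (gpd S)"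
    and rng_act: "\<lbrakk>g \<in> elems (gpd S); e \<in> arcs (graph S); gsrc (gpd S) g = head (graph S) e\<rbrakk>
          \<Longrightarrow> head (graph S) (act S g e) = grng (gpd S) g"
    and act_mult: "\<lbrakk>h \<in> elems (gpd S); g \<in> elems (gpd S); e \<in> arcs (graph S);
             gsrc (gpd S) h = grng (gpd S) g; gsrc (gpd S) g = head (graph S) e\<rbrakk>
          \<Longrightarrow> act S (gmult (gpd S) h g) e = act S h (act S g e)"
    and act_unit: "e \<in> arcs (graph S) \<Longrightarrow> act S (head (graph S) e) e = e"
    and restr_mult: "\<lbrakk>h \<in> elems (gpd S); g \<in> elems (gpd S); e \<in> arcs (graph S);
             gsrc (gpd S) h = grng (gpd S) g; gsrc (gpd S) g = head (graph S) e\<rbrakk>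
          \<Longrightarrow> restr S (gmult (gpd S) h g) e = gmult (gpd S) (restr S h (act S g e)) (restr S g e)"
    and src_restr: "\<lbrakk>g \<in> elems (gpd S); e \<in> arcs (graph S); gsrc (gpd S) g = head (graph S) e\<rbrakk>
          \<Longrightarrow> gsrc (gpd S) (restr S g e) = tail (graph S) e"
    and rng_restr: "\<lbrakk>g \<in> elems (gpd S); e \<in> arcs (graph S); gsrc (gpd S) g = head (graph S) e\<rbrakk>
          \<Longrightarrow> grng (gpd S) (restr S g e) = tail (graph S) (act S g e)"

text \<open>The extensions to paths are meaningful for paths whose range is \<open>s(g)\<close>; they are only used there.\<close>

primrec act_list :: "('g, 'e) action_struct \<Rightarrow> 'g \<Rightarrow> 'e list \<Rightarrow> 'e list" where
  "act_list S g [] = []"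
| "act_list S g (e # es) = act S g e # act_list S (restr S g e) es"

primrec restr_list :: "('g, 'e) action_struct \<Rightarrow> 'g \<Rightarrow> 'e list \<Rightarrow> 'g" where
  "restr_list S g [] = g"
| "restr_list S g (e # es) = restr_list S (restr S g e) es"

primcorec act_stream :: "('g, 'e) action_struct \<Rightarrow> 'g \<Rightarrow> 'e stream \<Rightarrow> 'e stream" where
  "shd (act_stream S g x) = act S g (shd x)"
| "stl (act_stream S g x) = act_stream S (restr S g (shd x)) (stl x)"

definition act_fin :: "('g, 'e) action_struct \<Rightarrow> 'g \<Rightarrow> ('g, 'e) fin_path \<Rightarrow> ('g, 'e) fin_path" where
  "act_fin S g p = (grng (gpd S) g, act_list S g (snd p))"

definition restr_fin :: "('g, 'e) action_struct \<Rightarrow> 'g \<Rightarrow> ('g, 'e) fin_path \<Rightarrow> 'g" where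
  "restr_fin S g p = restr_list S g (snd p)"

primrec act_ext :: "('g, 'e) action_struct \<Rightarrow> 'g \<Rightarrow> ('g, 'e) ext_path \<Rightarrow> ('g, 'e) ext_path" where
  "act_ext S g (FinPath p) = FinPath (act_fin S g p)"
| "act_ext S g (InfPath x) = InfPath (act_stream S g x)"

definition contracting_set :: "('g, 'e) action_struct \<Rightarrow> 'g set \<Rightarrow> bool" where
  "contracting_set S N \<longleftrightarrow> finite N \<and> N \<subseteq> elems (gpd S) \<and>
     (\<forall>g\<in>elems (gpd S). \<exists>n. \<forall>p\<in>fin_paths (graph S).
        fin_rng p = gsrc (gpd S) g \<and> n \<le> path_length p \<longrightarrow> restr_fin S g p \<in> N)"

locale contracting_action = self_similar_action +
  assumes finite_graph: "fin_digraph (graph S)"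
    and no_sources: "v \<in> verts (graph S) \<Longrightarrow> in_arcs (graph S) v \<noteq> {}"
    and contracting: "\<exists>N. contracting_set S N"

text \<open>Contracting sets are closed under binary intersections and finite, so a smallest one exists
  as soon as there is any.\<close>

definition nucleus :: "('g, 'e) action_struct \<Rightarrow> 'g set" where
  "nucleus S = (LEAST N. contracting_set S N)"

definition strongly_fixed_fin :: "('g, 'e) action_struct \<Rightarrow> 'g \<Rightarrow> ('g, 'e) fin_path \<Rightarrow> bool" where
  "strongly_fixed_fin S g p \<longleftrightarrow> p \<in> fin_paths (graph S) \<and> fin_rng p = gsrc (gpd S) g
     \<and> act_fin S g p = p \<and> restr_fin S g p = fin_src (graph S) p"

definition strongly_fixed_inf :: "('g, 'e) action_struct \<Rightarrow> 'g \<Rightarrow> 'e stream \<Rightarrow> bool" where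
  "strongly_fixed_inf S g x \<longleftrightarrow>
     (\<exists>p. is_prefix (graph S) p (InfPath x) \<and> strongly_fixed_fin S g p)"

definition singular_decomposition ::
    "('g, 'e) action_struct \<Rightarrow> ('g, 'e) ext_path \<Rightarrow> ('g, 'e) fin_path \<Rightarrow> 'g \<Rightarrow> bool" where
  "singular_decomposition S \<mu> \<alpha> g \<longleftrightarrow>
     \<alpha> \<in> fin_paths (graph S) \<and> g \<in> elems (gpd S) \<and> fin_src (graph S) \<alpha> = grng (gpd S) g \<and>
     (\<exists>\<xi>\<in>inf_paths (graph S).
        ext_rng (graph S) (InfPath \<xi>) = fin_src (graph S) \<alpha> \<and> \<mu> = ext_append \<alpha> (InfPath \<xi>) \<and>
        \<not> strongly_fixed_inf S g \<xi> \<and>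
        (\<forall>\<beta>. is_prefix (graph S) \<beta> (InfPath \<xi>) \<longrightarrow>
           (\<exists>\<gamma>. is_prefix (graph S) \<beta> (FinPath \<gamma>) \<and> strongly_fixed_fin S g \<gamma>)))"


section \<open>The groupoid of germs\<close>

type_synonym ('g, 'e) germ_rep =
  "('g, 'e) fin_path \<times> 'g \<times> ('g, 'e) fin_path \<times> ('g, 'e) ext_path"

definition germ_reps :: "('g, 'e) action_struct \<Rightarrow> ('g, 'e) germ_rep set" where
  "germ_reps S = {(\<alpha>, g, \<beta>, \<xi>). \<alpha> \<in> fin_paths (graph S) \<and> \<beta> \<in> fin_paths (graph S) \<and>
     g \<in> elems (gpd S) \<and> grng (gpd S) g = fin_src (graph S) \<alpha> \<and>
     gsrc (gpd S) g = fin_src (graph S) \<beta> \<and> \<xi> \<in> cylinder (graph S) \<beta>}"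

definition germ_rel :: "('g, 'e) action_struct \<Rightarrow> ('g, 'e) germ_rep rel" where
  "germ_rel S = {((\<alpha>, g, \<beta>, \<xi>), (\<gamma>, h, \<delta>, \<eta>)).
     (\<alpha>, g, \<beta>, \<xi>) \<in> germ_reps S \<and> (\<gamma>, h, \<delta>, \<eta>) \<in> germ_reps S \<and> \<xi> = \<eta> \<and>
     (\<exists>\<beta>'\<in>fin_paths (graph S). \<exists>\<delta>'\<in>fin_paths (graph S).
        fin_rng \<beta>' = fin_src (graph S) \<beta> \<and> fin_rng \<delta>' = fin_src (graph S) \<delta> \<and>
        fin_append \<beta> \<beta>' = fin_append \<delta> \<delta>' \<and> is_prefix (graph S) (fin_append \<beta> \<beta>') \<xi> \<and>
        fin_append \<alpha> (act_fin S g \<beta>') = fin_append \<gamma> (act_fin S h \<delta>') \<and>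
        restr_fin S g \<beta>' = restr_fin S h \<delta>')}"

definition germ :: "('g, 'e) action_struct \<Rightarrow> ('g, 'e) fin_path \<Rightarrow> 'g \<Rightarrow> ('g, 'e) fin_path
    \<Rightarrow> ('g, 'e) ext_path \<Rightarrow> ('g, 'e) germ_rep set" where
  "germ S \<alpha> g \<beta> \<xi> = germ_rel S `` {(\<alpha>, g, \<beta>, \<xi>)}"

definition germs :: "('g, 'e) action_struct \<Rightarrow> ('g, 'e) germ_rep set set" where
  "germs S = germ_reps S // germ_rel S"

text \<open>Source and range do not depend on the representative, so the sets below are singletons when
  \<open>c\<close> is a germ.\<close>

definition germ_src :: "('g, 'e) action_struct \<Rightarrow> ('g, 'e) germ_rep set \<Rightarrow> ('g, 'e) ext_path" where
  "germ_src S c = the_elem {\<xi>. \<exists>\<alpha> g \<beta>. (\<alpha>, g, \<beta>, \<xi>) \<in> c}"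

definition germ_rng :: "('g, 'e) action_struct \<Rightarrow> ('g, 'e) germ_rep set \<Rightarrow> ('g, 'e) ext_path" where
  "germ_rng S c = the_elem {ext_append \<alpha> (act_ext S g \<xi>) | \<alpha> g \<beta> \<xi>.
     \<xi> \<in> ext_paths (graph S) \<and> ext_rng (graph S) \<xi> = fin_src (graph S) \<beta> \<and>
     (\<alpha>, g, \<beta>, ext_append \<beta> \<xi>) \<in> c}"

definition germ_unit :: "('g, 'e) action_struct \<Rightarrow> ('g, 'e) ext_path \<Rightarrow> ('g, 'e) germ_rep set" where
  "germ_unit S \<xi> = (let v = ext_rng (graph S) \<xi> in germ S (v, []) v (v, []) \<xi>)"

definition germ_topology :: "('g, 'e) action_struct \<Rightarrow> ('g, 'e) germ_rep set topology" where
  "germ_topology S = topology_generated_by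
     {{germ S \<alpha> g \<beta> \<xi> | \<xi>. \<xi> \<in> V} | \<alpha> g \<beta> V.
        \<alpha> \<in> fin_paths (graph S) \<and> \<beta> \<in> fin_paths (graph S) \<and> g \<in> elems (gpd S) \<and>
        grng (gpd S) g = fin_src (graph S) \<alpha> \<and> gsrc (gpd S) g = fin_src (graph S) \<beta> \<and>
        openin (path_topology (graph S)) V \<and> V \<subseteq> cylinder (graph S) \<beta>}"

definition boundary_germs :: "('g, 'e) action_struct \<Rightarrow> ('g, 'e) germ_rep set set" where
  "boundary_germs S =
     {c \<in> germs S. germ_src S c \<in> boundary (graph S) \<and> germ_rng S c \<in> boundary (graph S)}"

definition boundary_germ_topology :: "('g, 'e) action_struct \<Rightarrow> ('g, 'e) germ_rep set topology" where
  "boundary_germ_topology S = subtopology (germ_topology S) (boundary_germs S)"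

definition Xbar :: "('g, 'e) action_struct \<Rightarrow> ('g, 'e) ext_path \<Rightarrow> ('g, 'e) germ_rep set set" where
  "Xbar S \<mu> = {c \<in> boundary_germs S. germ_rng S c = \<mu> \<and> germ_src S c = \<mu> \<and>
     c \<in> boundary_germ_topology S closure_of (germ_unit S ` boundary (graph S))}"

definition finitely_non_Hausdorff :: "'a topology \<Rightarrow> bool" where
  "finitely_non_Hausdorff T \<longleftrightarrow> (\<forall>y\<in>topspace T.
     finite {z \<in> topspace T. \<not> (\<exists>U V. openin T U \<and> openin T V \<and> y \<in> U \<and> z \<in> V \<and> disjnt U V)})"

end

(*
  Two germs over the same infinite path x that cannot be separated have, over every prefix of x,
  representatives [\<alpha>, g, \<beta>] and [\<alpha>, h, \<beta>] such that g and h act in the same way on longer and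
  longer prefixes t of the remaining path. Hence h|t = g|t n with n = (g^-1 h)|t, and contraction
  puts n into the nucleus as soon as t is long. So a germ y over x and an element of the nucleus
  determine any germ that is inseparable from y, which bounds the number of the latter by |N|;
  germs over finite paths are isolated because the graph is finite. An element of Xbar(\<mu>) is
  inseparable from the unit \<mu>, so it has the form [\<alpha>, n, \<alpha>; \<mu>] for all long prefixes \<alpha>; the
  length needed is uniform since Xbar(\<mu>) turns out to be finite. Such a germ is a limit of units
  iff every prefix of the remaining path has a strongly n-fixed extension, and is itself the unit
  iff the remaining path is strongly n-fixed.
*)
theory Submission
  imports Defs "HOL-Library.Sublist"
begin

text \<open>The length from which contraction yields an element of the nucleus depends on the germ,
  and nothing bounds the number of inseparable germs beforehand, so no single injection into the
  nucleus is at hand. The count uses instead a sequence of maps \<open>f k\<close> from the nucleus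
  to germs, independent of the germ to be counted, such that each germ lies in the image of
  \<open>f k\<close> for all large \<open>k\<close>. Finitely many germs then fit into one image.
  Counting gives the bound |N| where the formula by itself only suggests |N| + 1, because the unit
  is itself counted among the germs [\<alpha>, n, \<alpha>; \<mu>]. Germs are never multiplied or
  inverted. The quotient of g and h is formed in the groupoid G, once both germs are written over a
  common prefix, and inseparability enters only through germ equality over nearby paths. Absence of
  sources enters twice: it removes finite paths from the boundary, and it lets a finite strongly
  fixed path continue to an infinite one, so that the units approximating a singular germ lie over
  the boundary.\<close>

lemma stream_eqI_stake:
  assumes "\<And>k. stake k x = stake k y"
  shows "x = y"
  by (metis assms lessI smap_alt stake_nth stream.map_ident)

lemma stake_take:
  "m \<le> k \<Longrightarrow> stake m x = take m (stake k x)"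
  by (simp add: take_stake min_def)

lemma prefix_stake: "m \<le> k \<Longrightarrow> prefix (stake m x) (stake k x)"
  by (metis stake_take take_is_prefix)

text \<open>The threshold for \<open>k\<close> may depend on \<open>z\<close>. Finitely many
  thresholds have a common bound, so every finite subset of \<open>Z\<close> lies in one image of
  \<open>N\<close>; an infinite \<open>Z\<close> would contain a subset with
  \<open>Suc (card N)\<close> elements.\<close>

lemma finite_card_le_if_eventually_image:
  assumes "finite N" and ev: "\<And>z. z \<in> Z \<Longrightarrow> \<forall>\<^sub>F k in sequentially. z \<in> f k ` N"
  shows "finite Z \<and> card Z \<le> card N"
proof -
  have *: "card F \<le> card N" if "finite F" "F \<subseteq> Z" for F
  proof -
    have "\<forall>\<^sub>F k in sequentially. \<forall>z\<in>F. z \<in> f k ` N"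
      using that ev by (intro eventually_ball_finite) auto
    then obtain k where "\<forall>z\<in>F. z \<in> f k ` N"
      by (auto dest: eventually_happens)
    then show ?thesis
      using \<open>finite N\<close> by (intro surj_card_le) auto
  qed
  have "finite Z"
  proof (rule ccontr)
    assume "infinite Z"
    then obtain F where "F \<subseteq> Z" "finite F" "card F = Suc (card N)"
      by (meson infinite_arbitrarily_large)
    with * show False by force
  qed
  with * show ?thesis by auto
qed

section \<open>Paths\<close>

lemma nil_in_fin_paths [simp]: "(v, []) \<in> fin_paths E \<longleftrightarrow> v \<in> verts E"
  by (auto simp: fin_paths_def)

lemma fin_src_nil [simp]: "fin_src E (v, []) = v"
  by (simp add: fin_src_def)

lemma fin_src_append: "fin_src E (v, es @ fs) = fin_src E (fin_src E (v, es), fs)"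
  by (simp add: fin_src_def)

lemma fin_src_Cons: "fin_src E (v, e # es) = fin_src E (tail E e, es)"
  by (simp add: fin_src_def)

context wf_digraph
begin

lemma Cons_in_fin_paths:
  "(v, e # es) \<in> fin_paths G \<longleftrightarrow> e \<in> arcs G \<and> head G e = v \<and> (tail G e, es) \<in> fin_paths G"
  by (cases es) (auto simp: fin_paths_def)

lemma append_in_fin_paths:
  "(v, es @ fs) \<in> fin_paths G \<longleftrightarrow>
     (v, es) \<in> fin_paths G \<and> (fin_src G (v, es), fs) \<in> fin_paths G"
proof (induction es arbitrary: v)
  case Nil
  show ?case by (auto simp: fin_paths_def)
next
  case (Cons e es)
  then show ?case by (auto simp: Cons_in_fin_paths fin_src_Cons)
qed

lemma fin_src_in_verts: "(v, es) \<in> fin_paths G \<Longrightarrow> fin_src G (v, es) \<in> verts G"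
  using append_in_fin_paths[of v es "[]"] by simp

lemma inf_paths_iff_Cons:
  "x \<in> inf_paths G \<longleftrightarrow> shd x \<in> arcs G \<and> stl x \<in> inf_paths G \<and> tail G (shd x) = head G (shd (stl x))"
  (is "?L \<longleftrightarrow> ?R")
proof
  assume ?L
  then have t: "tail G (x !! i) = head G (x !! Suc i)" and "sset x \<subseteq> arcs G" for i
    by (auto simp: inf_paths_def)
  moreover have "tail G (stl x !! i) = head G (stl x !! Suc i)" for i
    using t[of "Suc i"] by simp
  moreover have "shd x \<in> sset x" "sset (stl x) \<subseteq> sset x"
    by (auto simp: shd_sset stl_sset)
  ultimately show ?R
    using t[of 0] unfolding inf_paths_def by auto
next
  assume R: ?R
  have "tail G (x !! i) = head G (x !! Suc i)" for i
    using R by (cases i) (auto simp: inf_paths_def)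
  moreover have "sset x \<subseteq> arcs G"
    using R by (cases x) (auto simp: inf_paths_def)
  ultimately show ?L by (auto simp: inf_paths_def)
qed

lemma shift_in_inf_paths:
  "es @- x \<in> inf_paths G \<and> head G (shd (es @- x)) = v \<longleftrightarrow>
     (v, es) \<in> fin_paths G \<and> x \<in> inf_paths G \<and> head G (shd x) = fin_src G (v, es)"
proof (induction es arbitrary: v)
  case Nil
  show ?case
    using inf_paths_iff_Cons[of x] by (auto simp: wellformed)
next
  case (Cons e es)
  have "(e # es) @- x \<in> inf_paths G \<and> head G (shd ((e # es) @- x)) = v \<longleftrightarrow>
      e \<in> arcs G \<and> head G e = v \<and> es @- x \<in> inf_paths G \<and> head G (shd (es @- x)) = tail G e"
    using inf_paths_iff_Cons[of "(e # es) @- x"] by auto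
  then show ?case
    by (simp only: Cons.IH Cons_in_fin_paths fin_src_Cons) auto
qed

lemma stake_in_fin_paths:
  assumes "x \<in> inf_paths G"
  shows "(head G (shd x), stake k x) \<in> fin_paths G" "sdrop k x \<in> inf_paths G"
    "head G (shd (sdrop k x)) = fin_src G (head G (shd x), stake k x)"
  using shift_in_inf_paths[of "stake k x" "sdrop k x" "head G (shd x)"] assms
  by (simp_all only: stake_sdrop) auto

end

text \<open>Ranges and composability are left out on purpose: prefixes of one path become plain
  lists that are linearly ordered by \<open>prefix\<close>, for finite and infinite paths alike.
  \<open>is_prefix_iff\<close> restores the vertex data.\<close>

primrec edge_prefix :: "'e list \<Rightarrow> ('v, 'e) ext_path \<Rightarrow> bool" where
  "edge_prefix es (FinPath p) = prefix es (snd p)"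
| "edge_prefix es (InfPath x) = (stake (length es) x = es)"

lemma edge_prefix_Nil [simp]: "edge_prefix [] \<xi>"
  by (cases \<xi>) auto

lemma edge_prefix_stake: "edge_prefix (stake k x) (InfPath x)"
  by simp

lemma edge_prefix_mono: "edge_prefix fs \<xi> \<Longrightarrow> prefix es fs \<Longrightarrow> edge_prefix es \<xi>"
proof (cases \<xi>)
  case (InfPath x)
  assume "edge_prefix fs \<xi>" "prefix es fs"
  then have "stake (length es) x = take (length es) fs" "take (length es) fs = es"
    using InfPath stake_take[of "length es" "length fs" x] by (auto simp: prefix_def)
  with InfPath show ?thesis by simp
qed auto

lemma edge_prefix_linear:
  assumes "edge_prefix es \<xi>" "edge_prefix fs \<xi>"
  shows "prefix es fs \<or> prefix fs es"
proof (cases \<xi>)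
  case (FinPath p)
  with assms show ?thesis by (auto dest: prefix_same_cases)
next
  case (InfPath x)
  with assms show ?thesis by (metis edge_prefix.simps(2) prefix_stake nle_le)
qed

lemma edge_prefix_shift: "edge_prefix (es @ fs) (InfPath (es @- x)) \<longleftrightarrow> edge_prefix fs (InfPath x)"
  by (simp add: stake_add[symmetric] stake_shift sdrop_shift)

text \<open>The range tells apart distinct vertices, whose only edge prefix is the empty list. A
  finite path differs from an infinite one at a prefix of the latter that is one edge too
  long.\<close>

lemma ext_path_eqI:
  assumes r: "ext_rng E \<xi> = ext_rng E \<eta>"
    and p: "\<And>es. edge_prefix es \<xi> \<longleftrightarrow> edge_prefix es \<eta>"
  shows "\<xi> = \<eta>"
proof (cases \<xi>)
  case (FinPath p)
  show ?thesis
  proof (cases \<eta>)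
    case (FinPath q)
    then show ?thesis
      using r p[of "snd p"] p[of "snd q"] \<open>\<xi> = FinPath p\<close>
      by (auto dest: prefix_order.antisym intro: prod_eqI)
  next
    case (InfPath y)
    then show ?thesis
      using p[of "stake (Suc (length (snd p))) y"] \<open>\<xi> = FinPath p\<close>
      by (auto dest: prefix_length_le)
  qed
next
  case (InfPath x)
  show ?thesis
  proof (cases \<eta>)
    case (FinPath q)
    then show ?thesis
      using p[of "stake (Suc (length (snd q))) x"] \<open>\<xi> = InfPath x\<close>
      by (auto dest: prefix_length_le)
  next
    case (InfPath y)
    then have "stake k x = stake k y" for k
      using p[of "stake k x"] \<open>\<xi> = InfPath x\<close> by simp
    with InfPath show ?thesis
      using \<open>\<xi> = InfPath x\<close> by (simp add: stream_eqI_stake)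
  qed
qed

context wf_digraph
begin

text \<open>The existential over the remaining path disappears: the remainder is what is left after
  cutting off \<open>es\<close>, and it is composable because the whole of \<open>\<xi>\<close> is a
  path.\<close>

lemma cylinder_iff:
  assumes "(v, es) \<in> fin_paths G"
  shows "\<xi> \<in> cylinder G (v, es) \<longleftrightarrow> \<xi> \<in> ext_paths G \<and> ext_rng G \<xi> = v \<and> edge_prefix es \<xi>"
proof (cases \<xi>)
  case (FinPath p)
  have "\<xi> \<in> cylinder G (v, es) \<longleftrightarrow> (\<exists>fs. p = (v, es @ fs) \<and> (fin_src G (v, es), fs) \<in> fin_paths G)"
    unfolding cylinder_def FinPath ext_paths_def by (auto simp: fin_append_def image_iff)
      (metis ext_append.simps(1) ext_rng.simps(1) fst_conv snd_conv fin_append_def)+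
  then show ?thesis
    using assms FinPath
    by (cases p) (auto simp: ext_paths_def append_in_fin_paths prefix_def)
next
  case (InfPath x)
  have "\<xi> \<in> cylinder G (v, es) \<longleftrightarrow>
      (\<exists>y. x = es @- y \<and> y \<in> inf_paths G \<and> head G (shd y) = fin_src G (v, es))"
    unfolding cylinder_def InfPath ext_paths_def by (auto simp: image_iff)
      (metis ext_append.simps(2) ext_rng.simps(2) snd_conv)
  also have "\<dots> \<longleftrightarrow> (\<exists>y. x = es @- y \<and> es @- y \<in> inf_paths G \<and> head G (shd (es @- y)) = v)"
    using assms shift_in_inf_paths by blast
  also have "\<dots> \<longleftrightarrow> x \<in> inf_paths G \<and> head G (shd x) = v \<and> stake (length es) x = es"
    (is "?L \<longleftrightarrow> ?R")
  proof
    assume ?L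
    then show ?R by (auto simp: stake_shift)
  next
    assume ?R
    moreover from this have "x = es @- sdrop (length es) x"
      by (metis stake_sdrop)
    ultimately show ?L by metis
  qed
  finally show ?thesis by (auto simp: InfPath ext_paths_def)
qed

lemma edge_prefix_in_fin_paths:
  assumes "\<xi> \<in> ext_paths G" "edge_prefix es \<xi>"
  shows "(ext_rng G \<xi>, es) \<in> fin_paths G"
proof (cases \<xi>)
  case (FinPath p)
  with assms show ?thesis
    by (cases p) (auto simp: ext_paths_def prefix_def append_in_fin_paths)
next
  case (InfPath x)
  with assms show ?thesis
    using stake_in_fin_paths(1)[of x "length es"] by (auto simp: ext_paths_def)
qed

lemma is_prefix_iff:
  "is_prefix G (v, es) \<xi> \<longleftrightarrow> \<xi> \<in> ext_paths G \<and> ext_rng G \<xi> = v \<and> edge_prefix es \<xi>"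
  unfolding is_prefix_def using cylinder_iff edge_prefix_in_fin_paths by blast

lemma cylinder_iff_is_prefix: "p \<in> fin_paths G \<Longrightarrow> \<xi> \<in> cylinder G p \<longleftrightarrow> is_prefix G p \<xi>"
  by (simp add: is_prefix_def)

end

section \<open>The action on paths\<close>

context groupoid
begin

lemma idempotent_is_unit:
  assumes g: "g \<in> elems G" "gsrc G g = grng G g" and idem: "gmult G g g = g"
  shows "g = gsrc G g"
proof -
  obtain h where h: "h \<in> elems G" "gsrc G h = grng G g" "grng G h = gsrc G g" "gmult G h g = gsrc G g"
    using inverse_exists g by blast
  have "gmult G h (gmult G g g) = gmult G (gmult G h g) g"
    using assoc[of h g g] g h by simp
  also have "\<dots> = g"
    using g h rng_mult_id[of g] by simp
  finally show ?thesis using idem h by simp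
qed

end

context self_similar_action
begin

abbreviation E where "E \<equiv> graph S"
abbreviation "src \<equiv> gsrc (gpd S)"
abbreviation "rng \<equiv> grng (gpd S)"
abbreviation "mult \<equiv> gmult (gpd S)"

lemma unit_of_vertex:
  assumes "v \<in> verts E"
  shows "v \<in> elems (gpd S)" "src v = v" "rng v = v"
  using assms groupoid.src_closed[OF groupoid] groupoid.src_src[OF groupoid]
    groupoid.rng_src[OF groupoid]
  by (auto simp: units[symmetric] units_def)

lemma src_rng_in_verts:
  assumes "g \<in> elems (gpd S)"
  shows "src g \<in> verts E" "rng g \<in> verts E"
  using assms groupoid.rng_closed[OF groupoid] groupoid.src_rng[OF groupoid]
  by (auto simp: units[symmetric] units_def image_iff) metis

text \<open>This is not an axiom. As the vertex v satisfies vv = v and ve = e, the product rule for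
  restrictions makes v|e idempotent, and an idempotent of a groupoid is a unit.\<close>

lemma restr_unit:
  assumes "e \<in> arcs E"
  shows "restr S (head E e) e = tail E e"
proof -
  let ?v = "head E e"
  have v: "?v \<in> elems (gpd S)" "src ?v = ?v" "rng ?v = ?v"
    using unit_of_vertex[of ?v] wf_digraph.head_in_verts[OF graph] assms by auto
  have vv: "mult ?v ?v = ?v"
    using groupoid.mult_src[OF groupoid v(1)] v by simp
  have g: "restr S ?v e \<in> elems (gpd S)" "src (restr S ?v e) = tail E e"
      "rng (restr S ?v e) = tail E e"
    using assms v restr_closed src_restr rng_restr act_unit by auto
  have "mult (restr S ?v e) (restr S ?v e) = restr S ?v e"
    using restr_mult[of ?v ?v e] v vv assms act_unit by simp
  then show ?thesis
    using groupoid.idempotent_is_unit[OF groupoid] g by metis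
qed

lemma length_act_list [simp]: "length (act_list S g es) = length es"
  by (induction es arbitrary: g) auto

lemma act_list_append: "act_list S g (es @ fs) = act_list S g es @ act_list S (restr_list S g es) fs"
  by (induction es arbitrary: g) auto

lemma restr_list_append: "restr_list S g (es @ fs) = restr_list S (restr_list S g es) fs"
  by (induction es arbitrary: g) auto

lemma act_list_closed:
  assumes "g \<in> elems (gpd S)" "(src g, es) \<in> fin_paths E"
  shows "(rng g, act_list S g es) \<in> fin_paths E" "restr_list S g es \<in> elems (gpd S)"
    "src (restr_list S g es) = fin_src E (src g, es)"
    "rng (restr_list S g es) = fin_src E (rng g, act_list S g es)"
proof -
  have "(rng g, act_list S g es) \<in> fin_paths E \<and> restr_list S g es \<in> elems (gpd S) \<and>
      src (restr_list S g es) = fin_src E (src g, es) \<and>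
      rng (restr_list S g es) = fin_src E (rng g, act_list S g es)"
    using assms
  proof (induction es arbitrary: g)
    case Nil
    then show ?case using src_rng_in_verts by simp
  next
    case (Cons e es)
    then have e: "e \<in> arcs E" "src g = head E e" "(tail E e, es) \<in> fin_paths E"
      by (auto simp: wf_digraph.Cons_in_fin_paths[OF graph])
    with Cons.IH[of "restr S g e"] Cons.prems show ?case
      by (simp add: wf_digraph.Cons_in_fin_paths[OF graph] fin_src_Cons
          act_closed restr_closed rng_act src_restr rng_restr)
  qed
  then show "(rng g, act_list S g es) \<in> fin_paths E" "restr_list S g es \<in> elems (gpd S)"
    "src (restr_list S g es) = fin_src E (src g, es)"
    "rng (restr_list S g es) = fin_src E (rng g, act_list S g es)"
    by auto
qed

lemma list_mult:
  assumes "h \<in> elems (gpd S)" "g \<in> elems (gpd S)" "src h = rng g" "(src g, es) \<in> fin_paths E"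
  shows "act_list S (mult h g) es = act_list S h (act_list S g es)"
    "restr_list S (mult h g) es = mult (restr_list S h (act_list S g es)) (restr_list S g es)"
proof -
  have "act_list S (mult h g) es = act_list S h (act_list S g es) \<and>
      restr_list S (mult h g) es = mult (restr_list S h (act_list S g es)) (restr_list S g es)"
    using assms
  proof (induction es arbitrary: h g)
    case (Cons e es)
    then have "e \<in> arcs E" "src g = head E e" "(tail E e, es) \<in> fin_paths E"
      by (auto simp: wf_digraph.Cons_in_fin_paths[OF graph])
    with Cons.IH[of "restr S h (act S g e)" "restr S g e"] Cons.prems show ?case
      by (simp add: act_mult restr_mult act_closed restr_closed rng_act src_restr rng_restr)
  qed simp
  then show "act_list S (mult h g) es = act_list S h (act_list S g es)"
    "restr_list S (mult h g) es = mult (restr_list S h (act_list S g es)) (restr_list S g es)"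
    by auto
qed

lemma list_unit:
  assumes "(v, es) \<in> fin_paths E"
  shows "act_list S v es = es" "restr_list S v es = fin_src E (v, es)"
proof -
  have "act_list S v es = es \<and> restr_list S v es = fin_src E (v, es)"
    using assms
  proof (induction es arbitrary: v)
    case (Cons e es)
    with Cons.IH[of "tail E e"] show ?case
      by (auto simp: wf_digraph.Cons_in_fin_paths[OF graph] act_unit restr_unit fin_src_Cons)
  qed simp
  then show "act_list S v es = es" "restr_list S v es = fin_src E (v, es)"
    by auto
qed

text \<open>With \<open>k = g\<^sup>-\<^sup>1h\<close>: if \<open>g\<close> and \<open>h\<close> act in the same way on \<open>es\<close>, then \<open>k\<close> fixes \<open>es\<close>.\<close>

lemma difference_element:
  assumes "g \<in> elems (gpd S)" "h \<in> elems (gpd S)" "src g = src h" "rng g = rng h"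
  obtains k where "k \<in> elems (gpd S)" "src k = src g" "rng k = src g"
    "\<And>es. \<lbrakk>(src g, es) \<in> fin_paths E; act_list S g es = act_list S h es\<rbrakk> \<Longrightarrow>
       act_list S k es = es \<and> restr_list S h es = mult (restr_list S g es) (restr_list S k es)"
proof -
  obtain i where i: "i \<in> elems (gpd S)" "src i = rng g" "rng i = src g"
      "mult g i = rng g" "mult i g = src g"
    using groupoid.inverse_exists[OF groupoid assms(1)] by blast
  define k where "k = mult i h"
  have k: "k \<in> elems (gpd S)" "src k = src g" "rng k = src g"
    using i assms groupoid.mult_closed[OF groupoid, of i h] groupoid.src_mult[OF groupoid, of i h]
      groupoid.rng_mult[OF groupoid, of i h] by (auto simp: k_def)
  have gk: "mult g k = h"
  proof -
    have "mult g k = mult (mult g i) h"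
      unfolding k_def using assms i groupoid.assoc[OF groupoid, of g i h] by simp
    then show ?thesis using assms i groupoid.rng_mult_id[OF groupoid, of h] by simp
  qed
  have "act_list S k es = es \<and> restr_list S h es = mult (restr_list S g es) (restr_list S k es)"
    if "(src g, es) \<in> fin_paths E" "act_list S g es = act_list S h es" for es
  proof -
    \<comment> \<open>Here \<open>k\<close> is \<open>mult i h\<close> and h may be replaced by g on
      \<open>es\<close>, so that \<open>i\<close> undoes the action of g.\<close>
    have "act_list S k es = act_list S i (act_list S g es)"
      unfolding k_def using list_mult(1)[of i h es] i assms that by simp
    also have "\<dots> = act_list S (src g) es"
      using list_mult(1)[of i g es] i assms that by simp
    also have "\<dots> = es" using list_unit(1)[OF that(1)] by simp
    finally have "act_list S k es = es" .
    with list_mult(2)[of g k es] gk k assms that show ?thesis by simp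
  qed
  with k show ?thesis using that by blast
qed

lemma stake_act_stream: "stake k (act_stream S g x) = act_list S g (stake k x)"
  by (induction k arbitrary: g x) auto

lemma act_stream_shift: "act_stream S g (es @- x) = act_list S g es @- act_stream S (restr_list S g es) x"
  by (induction es arbitrary: g) (auto intro: stream.expand)

end

section \<open>Germs\<close>

text \<open>The germs \<open>[\<alpha>, g, \<beta>; \<xi>]\<close> and \<open>[\<gamma>, h, \<delta>; \<xi>]\<close> agree iff their values agree at some prefix \<open>p\<close> of
  \<open>\<xi>\<close>, where \<open>[\<alpha>, g, \<beta>; \<xi>]\<close> has the value \<open>(\<alpha>(gq), g|\<^sub>q)\<close> at \<open>p = \<beta>q\<close>.\<close>

definition germ_val :: "('g, 'e) action_struct \<Rightarrow> ('g, 'e) fin_path \<Rightarrow> 'g \<Rightarrow> ('g, 'e) fin_path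
    \<Rightarrow> 'e list \<Rightarrow> ('g, 'e) fin_path \<times> 'g" where
  "germ_val S \<alpha> g \<beta> p =
     (let q = drop (length (snd \<beta>)) p in ((fst \<alpha>, snd \<alpha> @ act_list S g q), restr_list S g q))"

context self_similar_action
begin

lemma germ_val_append [simp]:
  "germ_val S \<alpha> g (v, p) (p @ q) = ((fst \<alpha>, snd \<alpha> @ act_list S g q), restr_list S g q)"
  by (simp add: germ_val_def)

text \<open>The value at \<open>p @ r\<close> depends only on the value at \<open>p\<close>: a pair
  (\<alpha>', g') becomes (\<alpha>'(g'r), g'|r). Agreement at one prefix therefore persists at all
  longer ones.\<close>

lemma germ_val_mono:
  assumes "germ_val S \<alpha> g \<beta> p = germ_val S \<gamma> h \<delta> p" "prefix (snd \<beta>) p" "prefix (snd \<delta>) p" "prefix p q"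
  shows "germ_val S \<alpha> g \<beta> q = germ_val S \<gamma> h \<delta> q"
proof -
  have *: "germ_val S \<alpha> g \<beta> (p @ r) = (let w = germ_val S \<alpha> g \<beta> p in
      ((fst (fst w), snd (fst w) @ act_list S (snd w) r), restr_list S (snd w) r))"
    if "prefix (snd \<beta>) p" for \<alpha> g \<beta> r
    using prefix_length_le[OF that]
    by (simp add: germ_val_def Let_def act_list_append restr_list_append)
  obtain r where "q = p @ r" using assms(4) by (auto simp: prefix_def)
  with assms * show ?thesis by metis
qed

lemma in_germ_reps_iff:
  "(\<alpha>, g, \<beta>, \<xi>) \<in> germ_reps S \<longleftrightarrow> \<alpha> \<in> fin_paths E \<and> g \<in> elems (gpd S) \<and> rng g = fin_src E \<alpha> \<and>
     src g = fin_src E \<beta> \<and> is_prefix E \<beta> \<xi>"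
  by (auto simp: germ_reps_def is_prefix_def)

text \<open>One edge list \<open>p\<close> replaces the two tails \<beta>' and \<delta>', which are
  the remainders of \<open>p\<close> after \<beta> and \<delta>. Their being paths follows from
  \<open>p\<close> being a prefix of the path \<open>\<xi>\<close>.\<close>

lemma germ_rel_iff:
  "((\<alpha>, g, \<beta>, \<xi>), (\<gamma>, h, \<delta>, \<eta>)) \<in> germ_rel S \<longleftrightarrow>
     (\<alpha>, g, \<beta>, \<xi>) \<in> germ_reps S \<and> (\<gamma>, h, \<delta>, \<eta>) \<in> germ_reps S \<and> \<xi> = \<eta> \<and>
     (\<exists>p. edge_prefix p \<xi> \<and> prefix (snd \<beta>) p \<and> prefix (snd \<delta>) p \<and> germ_val S \<alpha> g \<beta> p = germ_val S \<gamma> h \<delta> p)"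
  (is "?L \<longleftrightarrow> ?R")
proof
  assume ?L
  then obtain \<beta>' \<delta>' where *: "(\<alpha>, g, \<beta>, \<xi>) \<in> germ_reps S" "(\<gamma>, h, \<delta>, \<eta>) \<in> germ_reps S" "\<xi> = \<eta>"
      "fin_append \<beta> \<beta>' = fin_append \<delta> \<delta>'" "is_prefix E (fin_append \<beta> \<beta>') \<xi>"
      "fin_append \<alpha> (act_fin S g \<beta>') = fin_append \<gamma> (act_fin S h \<delta>')"
      "restr_fin S g \<beta>' = restr_fin S h \<delta>'"
    unfolding germ_rel_def by blast
  then have "snd \<beta> @ snd \<beta>' = snd \<delta> @ snd \<delta>'" "edge_prefix (snd \<beta> @ snd \<beta>') \<xi>"
    by (auto simp: fin_append_def wf_digraph.is_prefix_iff[OF graph])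
  moreover have "germ_val S \<alpha> g \<beta> (snd \<beta> @ snd \<beta>') = germ_val S \<gamma> h \<delta> (snd \<delta> @ snd \<delta>')"
    using *(6,7) by (simp add: germ_val_def Let_def fin_append_def act_fin_def restr_fin_def)
  ultimately show ?R
    using *(1-3) by (metis prefixI)
next
  assume R: ?R
  then obtain p where p: "edge_prefix p \<xi>" "prefix (snd \<beta>) p" "prefix (snd \<delta>) p"
      "germ_val S \<alpha> g \<beta> p = germ_val S \<gamma> h \<delta> p" by blast
  then obtain b d where bd: "p = snd \<beta> @ b" "p = snd \<delta> @ d"
    unfolding prefix_def by blast
  have "is_prefix E \<beta> \<xi>" "is_prefix E \<delta> \<xi>" using R by (auto simp: in_germ_reps_iff)
  then have \<xi>: "\<xi> \<in> ext_paths E" "ext_rng E \<xi> = fst \<beta>" "fst \<delta> = fst \<beta>"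
    by (cases \<beta>; cases \<delta>; auto simp: wf_digraph.is_prefix_iff[OF graph])+
  have "(fst \<beta>, p) \<in> fin_paths E"
    using wf_digraph.edge_prefix_in_fin_paths[OF graph \<xi>(1) p(1)] \<xi> by simp
  then have "(fin_src E \<beta>, b) \<in> fin_paths E" "(fin_src E \<delta>, d) \<in> fin_paths E"
    using bd \<xi> wf_digraph.append_in_fin_paths[OF graph] by (metis prod.collapse)+
  moreover have "is_prefix E (fst \<beta>, p) \<xi>"
    using \<xi> p by (simp add: wf_digraph.is_prefix_iff[OF graph])
  moreover have "fst \<alpha> = fst \<gamma>" "snd \<alpha> @ act_list S g b = snd \<gamma> @ act_list S h d"
      "restr_list S g b = restr_list S h d"
    using p(4) bd unfolding germ_val_def by (metis Pair_inject append_eq_conv_conj)+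
  moreover have "fin_append \<beta> (fin_src E \<beta>, b) = (fst \<beta>, p)"
      "fin_append \<delta> (fin_src E \<delta>, d) = (fst \<beta>, p)"
    using bd \<xi> by (simp_all add: fin_append_def)
  ultimately have "\<exists>\<beta>'\<in>fin_paths E. \<exists>\<delta>'\<in>fin_paths E.
      fst \<beta>' = fin_src E \<beta> \<and> fst \<delta>' = fin_src E \<delta> \<and>
      fin_append \<beta> \<beta>' = fin_append \<delta> \<delta>' \<and> is_prefix E (fin_append \<beta> \<beta>') \<xi> \<and>
      fin_append \<alpha> (act_fin S g \<beta>') = fin_append \<gamma> (act_fin S h \<delta>') \<and>
      restr_fin S g \<beta>' = restr_fin S h \<delta>'"
    by (intro bexI[of _ "(fin_src E \<beta>, b)"] bexI[of _ "(fin_src E \<delta>, d)"])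
      (simp_all add: fin_append_def act_fin_def restr_fin_def)
  with R show ?L unfolding germ_rel_def mem_Collect_eq prod.case by blast
qed

text \<open>For transitivity, the two witnesses are prefixes of the same path and hence comparable;
  by \<open>germ_val_mono\<close> the longer one serves for both relations.\<close>

lemma equiv_germ_rel: "equiv (germ_reps S) (germ_rel S)"
proof (rule equivI)
  show "germ_rel S \<subseteq> germ_reps S \<times> germ_reps S" by (auto simp: germ_rel_def)
  show "refl_on (germ_reps S) (germ_rel S)"
  proof (rule refl_onI)
    fix r assume r: "r \<in> germ_reps S"
    obtain \<alpha> g v es \<xi> where "r = (\<alpha>, g, (v, es), \<xi>)" by (metis prod.exhaust)
    with r show "(r, r) \<in> germ_rel S"
      by (auto simp: germ_rel_iff in_germ_reps_iff wf_digraph.is_prefix_iff[OF graph])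
  qed
  show "sym (germ_rel S)"
    by (rule symI) (clarsimp simp: germ_rel_iff, metis)
  show "trans (germ_rel S)"
  proof (rule transI)
    fix r s t assume rs: "(r, s) \<in> germ_rel S" and st: "(s, t) \<in> germ_rel S"
    obtain \<alpha> g \<beta> \<xi> where r: "r = (\<alpha>, g, \<beta>, \<xi>)" by (metis prod.exhaust)
    obtain \<gamma> h \<delta> \<eta> where s: "s = (\<gamma>, h, \<delta>, \<eta>)" by (metis prod.exhaust)
    obtain \<epsilon> k \<zeta> \<theta> where t: "t = (\<epsilon>, k, \<zeta>, \<theta>)" by (metis prod.exhaust)
    have *: "r \<in> germ_reps S" "t \<in> germ_reps S" "\<xi> = \<eta>" "\<eta> = \<theta>"
        "\<exists>p. edge_prefix p \<xi> \<and> prefix (snd \<beta>) p \<and> prefix (snd \<delta>) p \<and> germ_val S \<alpha> g \<beta> p = germ_val S \<gamma> h \<delta> p"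
        "\<exists>p. edge_prefix p \<xi> \<and> prefix (snd \<delta>) p \<and> prefix (snd \<zeta>) p \<and> germ_val S \<gamma> h \<delta> p = germ_val S \<epsilon> k \<zeta> p"
      using rs[unfolded r s germ_rel_iff] st[unfolded s t germ_rel_iff] unfolding r t by blast+
    from *(5) obtain p where p: "edge_prefix p \<xi>" "prefix (snd \<beta>) p" "prefix (snd \<delta>) p"
        "germ_val S \<alpha> g \<beta> p = germ_val S \<gamma> h \<delta> p" by blast
    from *(6) obtain q where q: "edge_prefix q \<xi>" "prefix (snd \<delta>) q" "prefix (snd \<zeta>) q"
        "germ_val S \<gamma> h \<delta> q = germ_val S \<epsilon> k \<zeta> q" by blast
    obtain w where w: "edge_prefix w \<xi>" "prefix p w" "prefix q w"
      using edge_prefix_linear[OF p(1) q(1)] p q by auto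
    with germ_val_mono[OF p(4,2,3) w(2)] germ_val_mono[OF q(4,2,3) w(3)] p q *(1-4)
    show "(r, t) \<in> germ_rel S"
      unfolding r t germ_rel_iff by (metis prefix_order.order_trans)
  qed
qed

lemma germ_eq_iff:
  assumes "(\<alpha>, g, \<beta>, \<xi>) \<in> germ_reps S" "(\<gamma>, h, \<delta>, \<eta>) \<in> germ_reps S"
  shows "germ S \<alpha> g \<beta> \<xi> = germ S \<gamma> h \<delta> \<eta> \<longleftrightarrow> \<xi> = \<eta> \<and>
     (\<exists>p. edge_prefix p \<xi> \<and> prefix (snd \<beta>) p \<and> prefix (snd \<delta>) p \<and> germ_val S \<alpha> g \<beta> p = germ_val S \<gamma> h \<delta> p)"
  unfolding germ_def using eq_equiv_class_iff[OF equiv_germ_rel assms] assms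
  by (simp add: germ_rel_iff)

text \<open>The witness of a germ equality may be taken beyond any given prefix \<open>q\<close>.
  This is how information about long prefixes is extracted from an equality whose witness is not
  under control.\<close>

lemma germ_eq_above:
  assumes "(\<alpha>, g, \<beta>, \<xi>) \<in> germ_reps S" "(\<gamma>, h, \<delta>, \<xi>) \<in> germ_reps S"
    "germ S \<alpha> g \<beta> \<xi> = germ S \<gamma> h \<delta> \<xi>" "edge_prefix q \<xi>"
  obtains p where "edge_prefix p \<xi>" "prefix q p" "prefix (snd \<beta>) p" "prefix (snd \<delta>) p"
    "germ_val S \<alpha> g \<beta> p = germ_val S \<gamma> h \<delta> p"
proof -
  obtain p where p: "edge_prefix p \<xi>" "prefix (snd \<beta>) p" "prefix (snd \<delta>) p"
        "germ_val S \<alpha> g \<beta> p = germ_val S \<gamma> h \<delta> p"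
    using assms germ_eq_iff by blast
  obtain w where w: "edge_prefix w \<xi>" "prefix p w" "prefix q w"
    using edge_prefix_linear[OF p(1) assms(4)] p assms by auto
  then show ?thesis
    using that[of w] p germ_val_mono[OF p(4,2,3) w(2)] by (meson prefix_order.order_trans)
qed

lemma in_germ_iff:
  assumes "(\<alpha>, g, \<beta>, \<xi>) \<in> germ_reps S"
  shows "(\<gamma>, h, \<delta>, \<eta>) \<in> germ S \<alpha> g \<beta> \<xi> \<longleftrightarrow>
    (\<gamma>, h, \<delta>, \<eta>) \<in> germ_reps S \<and> germ S \<gamma> h \<delta> \<eta> = germ S \<alpha> g \<beta> \<xi>"
proof -
  have "(\<gamma>, h, \<delta>, \<eta>) \<in> germ S \<alpha> g \<beta> \<xi> \<longleftrightarrow> ((\<alpha>, g, \<beta>, \<xi>), (\<gamma>, h, \<delta>, \<eta>)) \<in> germ_rel S"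
    by (simp add: germ_def)
  also have "\<dots> \<longleftrightarrow> (\<gamma>, h, \<delta>, \<eta>) \<in> germ_reps S \<and> germ S \<gamma> h \<delta> \<eta> = germ S \<alpha> g \<beta> \<xi>"
    using equiv_class_eq[OF equiv_germ_rel] eq_equiv_class_iff[OF equiv_germ_rel assms]
    unfolding germ_def by (metis germ_rel_iff)
  finally show ?thesis .
qed

lemma germs_cases:
  assumes "c \<in> germs S"
  obtains \<alpha> g \<beta> \<xi> where "(\<alpha>, g, \<beta>, \<xi>) \<in> germ_reps S" "c = germ S \<alpha> g \<beta> \<xi>"
  using assms unfolding germs_def germ_def by (auto elim!: quotientE)

lemma germ_in_germs: "(\<alpha>, g, \<beta>, \<xi>) \<in> germ_reps S \<Longrightarrow> germ S \<alpha> g \<beta> \<xi> \<in> germs S"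
  unfolding germs_def germ_def by (rule quotientI)

lemma germ_src_germ:
  assumes "(\<alpha>, g, \<beta>, \<xi>) \<in> germ_reps S"
  shows "germ_src S (germ S \<alpha> g \<beta> \<xi>) = \<xi>"
proof -
  have "\<eta> = \<xi>" if "(\<gamma>, h, \<delta>, \<eta>) \<in> germ S \<alpha> g \<beta> \<xi>" for \<gamma> h \<delta> \<eta>
    using that in_germ_iff[OF assms] germ_eq_iff[OF _ assms] by blast
  moreover have "(\<alpha>, g, \<beta>, \<xi>) \<in> germ S \<alpha> g \<beta> \<xi>"
    using in_germ_iff[OF assms] assms by blast
  ultimately have "{\<eta>. \<exists>\<gamma> h \<delta>. (\<gamma>, h, \<delta>, \<eta>) \<in> germ S \<alpha> g \<beta> \<xi>} = {\<xi>}" by blast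
  then show ?thesis unfolding germ_src_def by simp
qed

text \<open>Lengthens \<beta> by \<open>q\<close>, which allows two germs over one path to be
  written with the same third component. Both sides take the same value at \<open>b @ q\<close>,
  where the new representative has nothing left to act on.\<close>

lemma germ_extend:
  assumes "((v, a), g, (w, b), \<xi>) \<in> germ_reps S" "edge_prefix (b @ q) \<xi>"
  shows "((v, a @ act_list S g q), restr_list S g q, (w, b @ q), \<xi>) \<in> germ_reps S"
    "germ S (v, a) g (w, b) \<xi> = germ S (v, a @ act_list S g q) (restr_list S g q) (w, b @ q) \<xi>"
proof -
  have *: "(v, a) \<in> fin_paths E" "g \<in> elems (gpd S)" "rng g = fin_src E (v, a)" "src g = fin_src E (w, b)"
      "\<xi> \<in> ext_paths E" "ext_rng E \<xi> = w"
    using assms by (auto simp: in_germ_reps_iff wf_digraph.is_prefix_iff[OF graph])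
  then have "(w, b @ q) \<in> fin_paths E"
    using wf_digraph.edge_prefix_in_fin_paths[OF graph *(5) assms(2)] by simp
  then have "(src g, q) \<in> fin_paths E"
    using * by (auto simp: wf_digraph.append_in_fin_paths[OF graph])
  note q = act_list_closed[OF *(2) this]
  show r: "((v, a @ act_list S g q), restr_list S g q, (w, b @ q), \<xi>) \<in> germ_reps S"
    using q * assms(2) by (simp add: in_germ_reps_iff wf_digraph.is_prefix_iff[OF graph]
        wf_digraph.append_in_fin_paths[OF graph] fin_src_append)
  show "germ S (v, a) g (w, b) \<xi> = germ S (v, a @ act_list S g q) (restr_list S g q) (w, b @ q) \<xi>"
    unfolding germ_eq_iff[OF assms(1) r]
    using assms(2) germ_val_append[of "(v, a @ act_list S g q)" "restr_list S g q" w "b @ q" "[]"]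
    by (intro conjI refl exI[of _ "b @ q"]) auto
qed

lemma germ_unit_eq:
  assumes "\<xi> \<in> ext_paths E" "edge_prefix p \<xi>"
  defines "v \<equiv> ext_rng E \<xi>"
  shows "((v, p), fin_src E (v, p), (v, p), \<xi>) \<in> germ_reps S"
    "germ_unit S \<xi> = germ S (v, p) (fin_src E (v, p)) (v, p) \<xi>"
proof -
  have p: "(v, p) \<in> fin_paths E"
    unfolding v_def by (rule wf_digraph.edge_prefix_in_fin_paths[OF graph assms(1,2)])
  then have v: "v \<in> verts E" by (auto simp: fin_paths_def)
  have r: "((v, []), v, (v, []), \<xi>) \<in> germ_reps S"
    using v unit_of_vertex[OF v] assms by (simp add: in_germ_reps_iff wf_digraph.is_prefix_iff[OF graph])
  note * = germ_extend[OF r, of p, unfolded list_unit[OF p] append_Nil, OF assms(2)]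
  show "((v, p), fin_src E (v, p), (v, p), \<xi>) \<in> germ_reps S" by (rule *(1))
  show "germ_unit S \<xi> = germ S (v, p) (fin_src E (v, p)) (v, p) \<xi>"
    unfolding germ_unit_def Let_def v_def[symmetric] by (rule *(2))
qed

text \<open>The bridge between germs and strongly fixed paths. With the unit written over the same
  prefix \<open>p\<close>, equality of the values at \<open>p @ q\<close> says that gq = q and that
  g|q is the vertex s(q).\<close>

lemma germ_eq_unit_iff:
  assumes "((v, p), g, (v, p), \<xi>) \<in> germ_reps S"
  shows "germ S (v, p) g (v, p) \<xi> = germ_unit S \<xi> \<longleftrightarrow>
     (\<exists>q. edge_prefix (p @ q) \<xi> \<and> strongly_fixed_fin S g (src g, q))"
proof -
  have *: "\<xi> \<in> ext_paths E" "ext_rng E \<xi> = v" "edge_prefix p \<xi>" "rng g = fin_src E (v, p)"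
      "src g = fin_src E (v, p)"
    using assms by (auto simp: in_germ_reps_iff wf_digraph.is_prefix_iff[OF graph])
  have path: "(fin_src E (v, p), q) \<in> fin_paths E" if "edge_prefix (p @ q) \<xi>" for q
    using wf_digraph.edge_prefix_in_fin_paths[OF graph *(1) that] *
    by (simp add: wf_digraph.append_in_fin_paths[OF graph])
  have u: "((v, p), fin_src E (v, p), (v, p), \<xi>) \<in> germ_reps S"
    "germ_unit S \<xi> = germ S (v, p) (fin_src E (v, p)) (v, p) \<xi>"
    using germ_unit_eq[OF *(1,3)] * by auto
  have "germ_val S (v, p) g (v, p) (p @ q) = germ_val S (v, p) (fin_src E (v, p)) (v, p) (p @ q) \<longleftrightarrow>
      strongly_fixed_fin S g (src g, q)" if "edge_prefix (p @ q) \<xi>" for q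
    using path[OF that] list_unit[OF path[OF that]] *
    by (auto simp: strongly_fixed_fin_def act_fin_def restr_fin_def)
  then show ?thesis
    unfolding u(2) germ_eq_iff[OF assms u(1)] by (auto simp: prefix_def)
qed

lemma germ_rng_germ:
  assumes r: "((v, a), g, (w, b), InfPath (b @- x)) \<in> germ_reps S"
  shows "germ_rng S (germ S (v, a) g (w, b) (InfPath (b @- x))) = InfPath (a @- act_stream S g x)"
proof -
  define c where "c = germ S (v, a) g (w, b) (InfPath (b @- x))"
  have rb: "is_prefix E (w, b) (InfPath (b @- x))" using r by (simp add: in_germ_reps_iff)
  \<comment> \<open>\<open>the_elem\<close> needs all representatives to give the same range. Beyond
    a witness \<open>p\<close> of the germ equality both paths continue with the same
    \<open>z\<close>, and both representatives act on \<open>z\<close> by the same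
    restriction.\<close>
  have uniq: "ext_append \<gamma> (act_ext S h \<eta>) = InfPath (a @- act_stream S g x)"
    if c: "(\<gamma>, h, \<delta>, ext_append \<delta> \<eta>) \<in> c" for \<gamma> h \<delta> \<eta>
  proof -
    obtain v' a' w' b' where gd: "\<gamma> = (v', a')" "\<delta> = (w', b')" by (metis prod.exhaust)
    have r': "((v', a'), h, (w', b'), ext_append \<delta> \<eta>) \<in> germ_reps S"
        and eq: "germ S (v, a) g (w, b) (InfPath (b @- x)) = germ S \<gamma> h \<delta> (ext_append \<delta> \<eta>)"
      using c in_germ_iff[OF r] by (auto simp: gd c_def)
    then have ext: "ext_append \<delta> \<eta> = InfPath (b @- x)"
      using germ_eq_iff[OF r] by (auto simp: gd)
    then obtain y where y: "\<eta> = InfPath y" "b' @- y = b @- x"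
      by (cases \<eta>) (auto simp: gd)
    obtain p where p: "edge_prefix p (InfPath (b @- x) :: ('g, 'e) ext_path)" "prefix b p" "prefix b' p"
        "germ_val S (v, a) g (w, b) p = germ_val S (v', a') h (w', b') p"
      using germ_eq_above[OF r r'[unfolded ext] eq[unfolded ext, unfolded gd] edge_prefix_Nil] by auto
    obtain q q' where q: "p = b @ q" "p = b' @ q'" using p(2,3) unfolding prefix_def by blast
    obtain z where z: "b @- x = p @- z"
      using p(1) by (metis edge_prefix.simps(2) stake_sdrop)
    have "x = q @- z" using z q(1) by (metis sdrop_shift diff_self_eq_0 drop_all order_refl sdrop.simps(1) shift.simps(1) shift_append)
    moreover have "y = q' @- z" using z q(2) y(2) by (metis sdrop_shift diff_self_eq_0 drop_all order_refl sdrop.simps(1) shift.simps(1) shift_append)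
    moreover have "a @ act_list S g q = a' @ act_list S h q'" "restr_list S g q = restr_list S h q'"
      using p(4) q by (metis germ_val_append Pair_inject snd_conv)+
    ultimately show ?thesis
      by (simp add: gd y act_stream_shift) (metis shift_append)
  qed
  have x: "InfPath x \<in> ext_paths E" "ext_rng E (InfPath x) = fin_src E (w, b)"
    using rb wf_digraph.shift_in_inf_paths[OF graph, of b x w]
    by (auto simp: wf_digraph.is_prefix_iff[OF graph] ext_paths_def)
  have c: "((v, a), g, (w, b), ext_append (w, b) (InfPath x)) \<in> c"
    using in_germ_iff[OF r] r by (simp add: c_def)
  have "{ext_append \<alpha> (act_ext S g \<xi>) | \<alpha> g \<beta> \<xi>. \<xi> \<in> ext_paths E \<and> ext_rng E \<xi> = fin_src E \<beta> \<and>
     (\<alpha>, g, \<beta>, ext_append \<beta> \<xi>) \<in> c} = {InfPath (a @- act_stream S g x)}" (is "?A = _")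
  proof
    show "?A \<subseteq> {InfPath (a @- act_stream S g x)}" using uniq by blast
    have "ext_append (v, a) (act_ext S g (InfPath x)) \<in> ?A" using x c by blast
    then show "{InfPath (a @- act_stream S g x)} \<subseteq> ?A" by simp
  qed
  then show ?thesis unfolding germ_rng_def c_def by simp
qed

end

section \<open>The topologies\<close>

context wf_digraph
begin

lemma is_prefix_in_fin_paths: "is_prefix G p \<xi> \<Longrightarrow> p \<in> fin_paths G"
  by (simp add: is_prefix_def)

lemma openin_cylinder_diff:
  assumes "(v, es) \<in> fin_paths G" "finite F" "\<And>fs. fs \<in> F \<Longrightarrow> (v, es @ fs) \<in> fin_paths G"
  shows "openin (path_topology G) (cylinder G (v, es) - (\<Union>fs\<in>F. cylinder G (v, es @ fs)))"
proof -
  define F' where "F' = Pair (fin_src G (v, es)) ` F"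
  have *: "finite F'" "F' \<subseteq> {q \<in> fin_paths G. fst q = fin_src G (v, es)}"
    using assms by (auto simp: F'_def append_in_fin_paths)
  have eq: "(\<Union>fs\<in>F. cylinder G (v, es @ fs)) = (\<Union>q\<in>F'. cylinder G (fin_append (v, es) q))"
    by (auto simp: F'_def fin_append_def)
  show ?thesis
    unfolding path_topology_def eq using assms(1) *
    by (intro topology_generated_by_Basis) blast
qed

lemma openin_cylinder: "p \<in> fin_paths G \<Longrightarrow> openin (path_topology G) (cylinder G p)"
  using openin_cylinder_diff[of "fst p" "snd p" "{}"] by simp

lemma neighbourhood_InfPath:
  assumes "openin (path_topology G) V" "InfPath x \<in> V"
  obtains k where "cylinder G (head G (shd x), stake k x) \<subseteq> V"
proof -
  have "generate_topology_on {cylinder G p - (\<Union>q\<in>F. cylinder G (fin_append p q)) | p F.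
        p \<in> fin_paths G \<and> finite F \<and> F \<subseteq> {q \<in> fin_paths G. fst q = fin_src G p}} V"
    using assms(1) unfolding path_topology_def by (rule openin_topology_generated_by)
  \<comment> \<open>Demanding all \<open>k\<close> from \<open>m\<close> on, and not just one, lets
    the intersection case use the maximum of two thresholds.\<close>
  then have "\<exists>m. \<forall>k\<ge>m. {\<eta>. is_prefix G (head G (shd x), stake k x) \<eta>} \<subseteq> V"
    using assms(2)
  proof (induction rule: generate_topology_on.induct)
    case Empty
    then show ?case by simp
  next
    case (Int a b)
    then obtain m m' where "\<forall>k\<ge>m. {\<eta>. is_prefix G (head G (shd x), stake k x) \<eta>} \<subseteq> a"
        "\<forall>k\<ge>m'. {\<eta>. is_prefix G (head G (shd x), stake k x) \<eta>} \<subseteq> b" by blast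
    then show ?case by (intro exI[of _ "max m m'"]) auto
  next
    case (UN K)
    then obtain U where "U \<in> K" "InfPath x \<in> U" by blast
    with UN.IH[of U] show ?case by blast
  next
    case (Basis U)
    then obtain v es F where U: "U = cylinder G (v, es) - (\<Union>q\<in>F. cylinder G (fin_append (v, es) q))"
        "(v, es) \<in> fin_paths G" "finite F" "F \<subseteq> {q \<in> fin_paths G. fst q = fin_src G (v, es)}"
      by auto
    have app: "fin_append (v, es) q = (v, es @ snd q)" "(v, es @ snd q) \<in> fin_paths G" if "q \<in> F" for q
    proof -
      have "q \<in> fin_paths G" "fst q = fin_src G (v, es)" using U(4) that by auto
      with U(2) show "fin_append (v, es) q = (v, es @ snd q)" "(v, es @ snd q) \<in> fin_paths G"
        by (cases q; simp add: fin_append_def append_in_fin_paths)+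
    qed
    have x: "is_prefix G (v, es) (InfPath x)"
      using Basis U by (auto simp: cylinder_iff_is_prefix)
    then have v: "head G (shd x) = v" by (simp add: is_prefix_iff)
    \<comment> \<open>The sum bounds every length occurring in \<open>F\<close> and also makes sense
      for empty \<open>F\<close>. A path that shares \<open>m\<close> edges with \<open>x\<close>
      and lies in a removed cylinder would force \<open>x\<close> itself into that cylinder.\<close>
    define m where "m = length es + (\<Sum>q\<in>F. length (snd q))"
    have "\<eta> \<in> U" if "k \<ge> m" and \<eta>: "is_prefix G (head G (shd x), stake k x) \<eta>" for k \<eta>
    proof -
      have "prefix es (stake k x)"
        using x that(1) prefix_stake[of "length es" k x] by (simp add: m_def is_prefix_iff)
      then have "\<eta> \<in> cylinder G (v, es)"
        using \<eta> U(2) v by (auto simp: cylinder_iff is_prefix_iff intro: edge_prefix_mono)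
      moreover have False if q: "q \<in> F" and "\<eta> \<in> cylinder G (fin_append (v, es) q)" for q
      proof -
        have "edge_prefix (es @ snd q) \<eta>" "edge_prefix (stake k x) \<eta>"
          using that app[OF q] \<eta> by (auto simp: cylinder_iff is_prefix_iff)
        moreover have "length (snd q) \<le> (\<Sum>q\<in>F. length (snd q))"
          using q U(3) by (meson member_le_sum zero_le)
        then have "length (es @ snd q) \<le> length (stake k x)"
          using \<open>k \<ge> m\<close> by (simp add: m_def)
        ultimately have "prefix (es @ snd q) (stake k x)"
          by (metis edge_prefix_linear prefix_length_le prefix_order.order_refl prefix_length_prefix)
        then have "InfPath x \<in> cylinder G (fin_append (v, es) q)"
          using x app[OF q] edge_prefix_mono[OF edge_prefix_stake]
          by (simp only: cylinder_iff is_prefix_iff) blast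
        with Basis(2) U(1) q show False by blast
      qed
      ultimately show ?thesis using U(1) by blast
    qed
    then show ?case by blast
  qed
  then obtain k where "{\<eta>. is_prefix G (head G (shd x), stake k x) \<eta>} \<subseteq> V" by blast
  moreover have "InfPath x \<in> ext_paths G"
  proof -
    have "V \<subseteq> topspace (path_topology G)" using assms(1) by (rule openin_subset)
    also have "\<dots> \<subseteq> ext_paths G"
      unfolding path_topology_def topology_generated_by_topspace by (auto simp: cylinder_iff)
    finally show ?thesis using assms(2) by blast
  qed
  then have "(head G (shd x), stake k x) \<in> fin_paths G"
    using edge_prefix_in_fin_paths[OF _ edge_prefix_stake] by fastforce
  ultimately have "cylinder G (head G (shd x), stake k x) \<subseteq> V"
    by (auto simp: is_prefix_def)
  then show ?thesis by (rule that)
qed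

text \<open>Two paths with the same range differ in some prefix \<open>es\<close>. The cylinder of
  \<open>es\<close> and its complement within the cylinder of the range vertex are both
  open.\<close>

lemma path_topology_Hausdorff:
  assumes "\<xi> \<in> ext_paths G" "\<eta> \<in> ext_paths G" "\<xi> \<noteq> \<eta>"
  obtains U V where "openin (path_topology G) U" "openin (path_topology G) V" "\<xi> \<in> U" "\<eta> \<in> V" "disjnt U V"
proof (cases "ext_rng G \<xi> = ext_rng G \<eta>")
  case False
  have "(ext_rng G \<xi>, []) \<in> fin_paths G" "(ext_rng G \<eta>, []) \<in> fin_paths G"
    using edge_prefix_in_fin_paths assms edge_prefix_Nil by blast+
  with False assms show ?thesis
    by (intro that[of "cylinder G (ext_rng G \<xi>, [])" "cylinder G (ext_rng G \<eta>, [])"] openin_cylinder)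
      (auto simp: cylinder_iff disjnt_def)
next
  case True
  have *: "\<exists>U V. openin (path_topology G) U \<and> openin (path_topology G) V \<and> \<xi> \<in> U \<and> \<eta> \<in> V \<and> disjnt U V"
    if "\<xi> \<in> ext_paths G" "\<eta> \<in> ext_paths G" "ext_rng G \<xi> = ext_rng G \<eta>"
      "edge_prefix es \<xi>" "\<not> edge_prefix es \<eta>" for es \<xi> \<eta>
  proof -
    define v where "v = ext_rng G \<xi>"
    have es: "(v, es) \<in> fin_paths G" "(v, []) \<in> fin_paths G"
      using edge_prefix_in_fin_paths[OF that(1,4)] edge_prefix_in_fin_paths[OF that(1) edge_prefix_Nil]
      by (auto simp: v_def)
    have "openin (path_topology G) (cylinder G (v, es))"
        "openin (path_topology G) (cylinder G (v, []) - cylinder G (v, es))"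
      using openin_cylinder openin_cylinder_diff[of v "[]" "{es}"] es by auto
    moreover have "\<xi> \<in> cylinder G (v, es)" "\<eta> \<in> cylinder G (v, []) - cylinder G (v, es)"
      using that(1,2,4,5) that(3)[symmetric]
      by (auto simp: cylinder_iff[OF es(1)] cylinder_iff[OF es(2)] v_def[symmetric])
    moreover have "disjnt (cylinder G (v, es)) (cylinder G (v, []) - cylinder G (v, es))"
      by (auto simp: disjnt_def)
    ultimately show ?thesis by blast
  qed
  obtain es where "edge_prefix es \<xi> \<noteq> edge_prefix es \<eta>"
    using ext_path_eqI[OF True] assms by blast
  then show ?thesis
    using *[of \<xi> \<eta> es] *[of \<eta> \<xi> es] assms True that by (metis disjnt_sym)
qed

text \<open>Every proper extension of the path runs through one of its finitely many one-edge
  extensions; removing their cylinders leaves the path alone.\<close>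

lemma openin_singleton_FinPath:
  assumes "(v, es) \<in> fin_paths G" "finite (in_arcs G (fin_src G (v, es)))"
  shows "openin (path_topology G) {FinPath (v, es)}"
proof -
  define F where "F = (\<lambda>e. [e]) ` in_arcs G (fin_src G (v, es))"
  have F: "(v, es @ fs) \<in> fin_paths G" if "fs \<in> F" for fs
    using that assms(1) by (auto simp: F_def append_in_fin_paths Cons_in_fin_paths)
  have "openin (path_topology G) (cylinder G (v, es) - (\<Union>fs\<in>F. cylinder G (v, es @ fs)))"
    using assms F by (intro openin_cylinder_diff) (auto simp: F_def)
  also have "cylinder G (v, es) - (\<Union>fs\<in>F. cylinder G (v, es @ fs)) = {FinPath (v, es)}"
  proof (intro equalityI subsetI)
    fix \<eta> assume \<eta>: "\<eta> \<in> cylinder G (v, es) - (\<Union>fs\<in>F. cylinder G (v, es @ fs))"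
    have "\<not> edge_prefix (es @ [e]) \<eta>" for e
    proof
      assume e: "edge_prefix (es @ [e]) \<eta>"
      have "\<eta> \<in> ext_paths G" "ext_rng G \<eta> = v" using \<eta> assms by (auto simp: cylinder_iff)
      from this edge_prefix_in_fin_paths[OF this(1) e] have "(v, es @ [e]) \<in> fin_paths G" by simp
      moreover from this have "[e] \<in> F" by (auto simp: F_def append_in_fin_paths Cons_in_fin_paths)
      ultimately show False
        using \<eta> e \<open>\<eta> \<in> ext_paths G\<close> \<open>ext_rng G \<eta> = v\<close> by (auto simp: cylinder_iff)
    qed
    note not_longer = this
    have "edge_prefix es \<eta>" "ext_rng G \<eta> = v" using \<eta> assms by (auto simp: cylinder_iff)
    then show "\<eta> \<in> {FinPath (v, es)}"
    proof (cases \<eta>)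
      case (FinPath p)
      with \<open>edge_prefix es \<eta>\<close> obtain fs where fs: "snd p = es @ fs" by (auto simp: prefix_def)
      have "fs = []"
        using not_longer[of "hd fs"] FinPath fs by (cases fs) auto
      with FinPath fs \<open>ext_rng G \<eta> = v\<close> show ?thesis by (cases p) auto
    next
      case (InfPath x)
      then have "edge_prefix (es @ [x !! length es]) \<eta>"
        using \<open>edge_prefix es \<eta>\<close> edge_prefix_stake[of "Suc (length es)" x] by (simp only: stake_Suc) simp
      with not_longer show ?thesis by blast
    qed
  next
    fix \<eta> assume "\<eta> \<in> {FinPath (v, es)}"
    then show "\<eta> \<in> cylinder G (v, es) - (\<Union>fs\<in>F. cylinder G (v, es @ fs))"
      using assms(1) F by (auto simp: cylinder_iff ext_paths_def F_def)
  qed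
  finally show ?thesis .
qed

end

section \<open>Points without disjoint neighbourhoods\<close>

definition inseparable :: "'a topology \<Rightarrow> 'a \<Rightarrow> 'a \<Rightarrow> bool" where
  "inseparable T y z \<longleftrightarrow> \<not> (\<exists>U V. openin T U \<and> openin T V \<and> y \<in> U \<and> z \<in> V \<and> disjnt U V)"

lemma inseparable_subtopology:
  assumes "inseparable (subtopology T A) y z" "y \<in> A" "z \<in> A"
  shows "inseparable T y z"
  unfolding inseparable_def
proof (rule notI, elim exE conjE)
  fix U V assume "openin T U" "openin T V" "y \<in> U" "z \<in> V" "disjnt U V"
  then have "openin (subtopology T A) (U \<inter> A)" "openin (subtopology T A) (V \<inter> A)"
      "y \<in> U \<inter> A" "z \<in> V \<inter> A" "disjnt (U \<inter> A) (V \<inter> A)"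
    using assms by (auto simp: openin_subtopology disjnt_def)
  with assms(1) show False unfolding inseparable_def by blast
qed

lemma finitely_non_Hausdorff_subtopology:
  assumes "finitely_non_Hausdorff T"
  shows "finitely_non_Hausdorff (subtopology T A)"
proof -
  have "{z \<in> topspace (subtopology T A). inseparable (subtopology T A) y z} \<subseteq>
      {z \<in> topspace T. inseparable T y z}" if "y \<in> topspace (subtopology T A)" for y
    using that inseparable_subtopology by auto
  with assms show ?thesis
    unfolding finitely_non_Hausdorff_def inseparable_def[symmetric]
    by (auto intro: finite_subset)
qed

section \<open>Neighbourhoods and inseparable pairs of germs\<close>

context self_similar_action
begin

lemma openin_germs:
  assumes "(\<alpha>, g, \<beta>, \<xi>) \<in> germ_reps S" "openin (path_topology E) V"
  shows "openin (germ_topology S) {germ S \<alpha> g \<beta> \<eta> | \<eta>. \<eta> \<in> V \<and> is_prefix E \<beta> \<eta>}"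
proof -
  have \<beta>: "\<beta> \<in> fin_paths E" using assms(1) by (auto simp: germ_reps_def)
  then have "openin (path_topology E) (V \<inter> cylinder E \<beta>)"
    using assms(2) wf_digraph.openin_cylinder[OF graph] by blast
  moreover have "{germ S \<alpha> g \<beta> \<eta> | \<eta>. \<eta> \<in> V \<and> is_prefix E \<beta> \<eta>} = {germ S \<alpha> g \<beta> \<eta> | \<eta>. \<eta> \<in> V \<inter> cylinder E \<beta>}"
    using \<beta> by (auto simp: is_prefix_def)
  ultimately show ?thesis
    using assms(1) unfolding germ_topology_def germ_reps_def
    by (intro topology_generated_by_Basis) blast
qed

lemma topspace_germ_topology: "topspace (germ_topology S) = germs S"
proof (intro equalityI subsetI)
  fix c assume "c \<in> topspace (germ_topology S)"
  then obtain \<alpha> g \<beta> V \<xi> where "\<alpha> \<in> fin_paths E" "\<beta> \<in> fin_paths E" "g \<in> elems (gpd S)"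
      "rng g = fin_src E \<alpha>" "src g = fin_src E \<beta>" "V \<subseteq> cylinder E \<beta>" "\<xi> \<in> V" "c = germ S \<alpha> g \<beta> \<xi>"
    unfolding germ_topology_def topology_generated_by_topspace by blast
  then have "(\<alpha>, g, \<beta>, \<xi>) \<in> germ_reps S" by (auto simp: germ_reps_def)
  with germ_in_germs \<open>c = _\<close> show "c \<in> germs S" by simp
next
  fix c assume "c \<in> germs S"
  then obtain \<alpha> g \<beta> \<xi> where r: "(\<alpha>, g, \<beta>, \<xi>) \<in> germ_reps S" "c = germ S \<alpha> g \<beta> \<xi>"
    by (elim germs_cases)
  have "openin (germ_topology S) {germ S \<alpha> g \<beta> \<eta> | \<eta>. \<eta> \<in> cylinder E \<beta> \<and> is_prefix E \<beta> \<eta>}"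
    using r by (intro openin_germs wf_digraph.openin_cylinder[OF graph]) (auto simp: germ_reps_def)
  moreover have "c \<in> {germ S \<alpha> g \<beta> \<eta> | \<eta>. \<eta> \<in> cylinder E \<beta> \<and> is_prefix E \<beta> \<eta>}"
    using r by (auto simp: germ_reps_def is_prefix_def)
  ultimately show "c \<in> topspace (germ_topology S)" using openin_subset by blast
qed

text \<open>A neighbourhood may always be described with the given representative. If a basic set
  comes with another one, the equality of the two germs is decided at some prefix \<open>p\<close>,
  so both representatives give the same germ over every path in the basic set that passes through
  \<open>p\<close>; shrinking to the cylinder of \<open>p\<close> suffices.\<close>

lemma neighbourhood_germ:
  assumes "openin (germ_topology S) U" "(\<alpha>, g, \<beta>, \<xi>) \<in> germ_reps S" "germ S \<alpha> g \<beta> \<xi> \<in> U"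
  obtains V where "openin (path_topology E) V" "\<xi> \<in> V"
    "\<And>\<eta>. \<lbrakk>\<eta> \<in> V; is_prefix E \<beta> \<eta>\<rbrakk> \<Longrightarrow> germ S \<alpha> g \<beta> \<eta> \<in> U"
proof -
  have "generate_topology_on {{germ S \<alpha> g \<beta> \<xi> | \<xi>. \<xi> \<in> V} | \<alpha> g \<beta> V.
        \<alpha> \<in> fin_paths (graph S) \<and> \<beta> \<in> fin_paths (graph S) \<and> g \<in> elems (gpd S) \<and>
        grng (gpd S) g = fin_src (graph S) \<alpha> \<and> gsrc (gpd S) g = fin_src (graph S) \<beta> \<and>
        openin (path_topology (graph S)) V \<and> V \<subseteq> cylinder (graph S) \<beta>} U"
    using assms(1) unfolding germ_topology_def by (rule openin_topology_generated_by)
  then have "\<exists>V. openin (path_topology E) V \<and> \<xi> \<in> V \<and>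
      (\<forall>\<eta>. \<eta> \<in> V \<and> is_prefix E \<beta> \<eta> \<longrightarrow> germ S \<alpha> g \<beta> \<eta> \<in> U)"
    using assms(3)
  proof (induction rule: generate_topology_on.induct)
    case Empty
    then show ?case by simp
  next
    case (Int a b)
    then obtain V W where "openin (path_topology E) V \<and> \<xi> \<in> V \<and>
      (\<forall>\<eta>. \<eta> \<in> V \<and> is_prefix E \<beta> \<eta> \<longrightarrow> germ S \<alpha> g \<beta> \<eta> \<in> a)"
      "openin (path_topology E) W \<and> \<xi> \<in> W \<and>
      (\<forall>\<eta>. \<eta> \<in> W \<and> is_prefix E \<beta> \<eta> \<longrightarrow> germ S \<alpha> g \<beta> \<eta> \<in> b)" by blast
    then show ?case by (intro exI[of _ "V \<inter> W"]) auto
  next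
    case (UN K)
    then obtain W where "W \<in> K" "germ S \<alpha> g \<beta> \<xi> \<in> W" by blast
    with UN.IH[of W] show ?case by blast
  next
    case (Basis W)
    then obtain \<gamma> h \<delta> V \<eta> where W: "W = {germ S \<gamma> h \<delta> \<xi> | \<xi>. \<xi> \<in> V}"
        "\<gamma> \<in> fin_paths E" "\<delta> \<in> fin_paths E" "h \<in> elems (gpd S)" "rng h = fin_src E \<gamma>"
        "src h = fin_src E \<delta>" "openin (path_topology E) V" "V \<subseteq> cylinder E \<delta>"
        "germ S \<alpha> g \<beta> \<xi> = germ S \<gamma> h \<delta> \<eta>" "\<eta> \<in> V" by blast
    have reps: "(\<gamma>, h, \<delta>, \<zeta>) \<in> germ_reps S" if "\<zeta> \<in> V" for \<zeta>
      using W that by (auto simp: germ_reps_def)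
    obtain p where "\<xi> = \<eta>" and p: "edge_prefix p \<xi>" "prefix (snd \<beta>) p" "prefix (snd \<delta>) p"
        "germ_val S \<alpha> g \<beta> p = germ_val S \<gamma> h \<delta> p"
      using germ_eq_iff[OF assms(2) reps[OF W(10)]] W(9) by blast
    have \<xi>: "\<xi> \<in> ext_paths E"
      using assms(2) by (cases \<beta>) (auto simp: in_germ_reps_iff wf_digraph.is_prefix_iff[OF graph])
    define v where "v = ext_rng E \<xi>"
    have v: "(v, p) \<in> fin_paths E"
      unfolding v_def using wf_digraph.edge_prefix_in_fin_paths[OF graph \<xi> p(1)] .
    have "openin (path_topology E) (V \<inter> cylinder E (v, p))"
      using W wf_digraph.openin_cylinder[OF graph v] by blast
    moreover have "\<xi> \<in> V \<inter> cylinder E (v, p)"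
      using W(10) \<open>\<xi> = \<eta>\<close> \<xi> p(1) by (simp add: wf_digraph.cylinder_iff[OF graph v]) (simp add: v_def)
    moreover have "germ S \<alpha> g \<beta> \<zeta> \<in> W" if "\<zeta> \<in> V \<inter> cylinder E (v, p)" "is_prefix E \<beta> \<zeta>" for \<zeta>
    proof -
      have "(\<alpha>, g, \<beta>, \<zeta>) \<in> germ_reps S" using assms(2) that by (simp add: in_germ_reps_iff)
      moreover have "edge_prefix p \<zeta>" using that by (simp add: wf_digraph.cylinder_iff[OF graph v])
      ultimately have "germ S \<alpha> g \<beta> \<zeta> = germ S \<gamma> h \<delta> \<zeta>"
        using germ_eq_iff reps that p by blast
      with that W(1) show ?thesis by blast
    qed
    ultimately show ?case by blast
  qed
  then show ?thesis using that by blast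
qed

text \<open>The basic neighbourhoods given by \<open>V\<close> and \<open>W\<close> share a germ,
  and since a germ has only one source, that germ lies over a single path \<open>\<zeta>\<close> in
  both sets.\<close>

lemma inseparable_germs:
  assumes "inseparable (germ_topology S) (germ S \<alpha> g \<beta> \<xi>) (germ S \<gamma> h \<delta> \<eta>)"
    and r: "(\<alpha>, g, \<beta>, \<xi>) \<in> germ_reps S" "(\<gamma>, h, \<delta>, \<eta>) \<in> germ_reps S"
    and V: "openin (path_topology E) V" "\<xi> \<in> V" and W: "openin (path_topology E) W" "\<eta> \<in> W"
  obtains \<zeta> where "\<zeta> \<in> V" "\<zeta> \<in> W" "(\<alpha>, g, \<beta>, \<zeta>) \<in> germ_reps S" "(\<gamma>, h, \<delta>, \<zeta>) \<in> germ_reps S"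
    "germ S \<alpha> g \<beta> \<zeta> = germ S \<gamma> h \<delta> \<zeta>"
proof -
  have pre: "is_prefix E \<beta> \<xi>" "is_prefix E \<delta> \<eta>" using r by (simp_all add: in_germ_reps_iff)
  define A where "A = {germ S \<alpha> g \<beta> \<zeta> | \<zeta>. \<zeta> \<in> V \<and> is_prefix E \<beta> \<zeta>}"
  define B where "B = {germ S \<gamma> h \<delta> \<zeta> | \<zeta>. \<zeta> \<in> W \<and> is_prefix E \<delta> \<zeta>}"
  have "germ S \<alpha> g \<beta> \<xi> \<in> A" "germ S \<gamma> h \<delta> \<eta> \<in> B"
    using V W pre unfolding A_def B_def by blast+
  moreover have "openin (germ_topology S) A" "openin (germ_topology S) B"
    using openin_germs r V W unfolding A_def B_def by blast+
  ultimately have "\<not> disjnt A B"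
    using assms(1) unfolding inseparable_def by blast
  then obtain c where "c \<in> A" "c \<in> B" unfolding disjnt_iff by blast
  from this(1) obtain \<zeta> where z: "\<zeta> \<in> V" "is_prefix E \<beta> \<zeta>" "c = germ S \<alpha> g \<beta> \<zeta>"
    unfolding A_def by blast
  from \<open>c \<in> B\<close> obtain \<theta> where t: "\<theta> \<in> W" "is_prefix E \<delta> \<theta>" "c = germ S \<gamma> h \<delta> \<theta>"
    unfolding B_def by blast
  have r': "(\<alpha>, g, \<beta>, \<zeta>) \<in> germ_reps S" "(\<gamma>, h, \<delta>, \<theta>) \<in> germ_reps S"
    using r z t by (simp_all add: in_germ_reps_iff)
  have "\<zeta> = \<theta>" using germ_eq_iff[OF r'] z(3) t(3) by simp
  with z t r' that show ?thesis by blast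
qed

lemma inseparable_germs_same_source:
  assumes "inseparable (germ_topology S) (germ S \<alpha> g \<beta> \<xi>) (germ S \<gamma> h \<delta> \<eta>)"
    and r: "(\<alpha>, g, \<beta>, \<xi>) \<in> germ_reps S" "(\<gamma>, h, \<delta>, \<eta>) \<in> germ_reps S"
  shows "\<xi> = \<eta>"
proof (rule ccontr)
  assume "\<xi> \<noteq> \<eta>"
  moreover have "\<xi> \<in> ext_paths E" "\<eta> \<in> ext_paths E"
    using r by (cases \<beta>; cases \<delta>; simp add: in_germ_reps_iff wf_digraph.is_prefix_iff[OF graph])+
  ultimately obtain U V where "openin (path_topology E) U" "openin (path_topology E) V" "\<xi> \<in> U" "\<eta> \<in> V" "disjnt U V"
    using wf_digraph.path_topology_Hausdorff[OF graph] by metis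
  then show False
    using inseparable_germs[OF assms, of U V] by (auto simp: disjnt_def)
qed

end

section \<open>Contracting actions\<close>

lemma contracting_set_Int:
  assumes "contracting_set S M" "contracting_set S N"
  shows "contracting_set S (M \<inter> N)"
  unfolding contracting_set_def
proof (intro conjI ballI)
  show "finite (M \<inter> N)" "M \<inter> N \<subseteq> elems (gpd S)"
    using assms by (auto simp: contracting_set_def)
  fix g assume "g \<in> elems (gpd S)"
  with assms obtain m n where
    "\<forall>p\<in>fin_paths (graph S). fin_rng p = gsrc (gpd S) g \<and> m \<le> path_length p \<longrightarrow> restr_fin S g p \<in> M"
    "\<forall>p\<in>fin_paths (graph S). fin_rng p = gsrc (gpd S) g \<and> n \<le> path_length p \<longrightarrow> restr_fin S g p \<in> N"
    unfolding contracting_set_def by meson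
  then show "\<exists>n. \<forall>p\<in>fin_paths (graph S). fin_rng p = gsrc (gpd S) g \<and> n \<le> path_length p \<longrightarrow> restr_fin S g p \<in> M \<inter> N"
    by (intro exI[of _ "max m n"]) auto
qed

text \<open>\<open>LEAST\<close> has a meaning here only if a contracting set is contained in all
  others. One of least cardinality is: its intersection with any other is again contracting, hence
  not smaller.\<close>

lemma contracting_set_nucleus:
  assumes "\<exists>N. contracting_set S N"
  shows "contracting_set S (nucleus S)"
proof -
  obtain N where N: "contracting_set S N" "\<And>M. contracting_set S M \<Longrightarrow> card N \<le> card M"
    using assms ex_has_least_nat[of "contracting_set S" _ card] by blast
  have "N \<subseteq> M" if "contracting_set S M" for M
  proof -
    have "card N \<le> card (N \<inter> M)"
      using N that contracting_set_Int by blast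
    moreover have "finite N" using N(1) by (simp add: contracting_set_def)
    ultimately have "N \<inter> M = N" by (intro card_seteq) auto
    then show ?thesis by blast
  qed
  then have "nucleus S = N"
    unfolding nucleus_def using N(1) by (intro Least_equality)
  with N show ?thesis by simp
qed

context contracting_action
begin

lemma finite_nucleus: "finite (nucleus S)"
  and nucleus_subset: "nucleus S \<subseteq> elems (gpd S)"
  using contracting_set_nucleus[OF contracting] by (auto simp: contracting_set_def)

lemma finite_in_arcs: "finite (in_arcs E v)"
  using finite_graph unfolding fin_digraph_def fin_digraph_axioms_def in_arcs_def by simp

lemma boundary_eq: "boundary E = InfPath ` inf_paths E"
  unfolding boundary_def singular_vertex_def
  using finite_in_arcs no_sources wf_digraph.fin_src_in_verts[OF graph] by auto

lemma eventually_restr_nucleus: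
  assumes "g \<in> elems (gpd S)" "x \<in> inf_paths E" "head E (shd x) = src g"
  shows "\<forall>\<^sub>F k in sequentially. restr_list S g (stake k x) \<in> nucleus S"
proof -
  obtain n where n: "\<forall>p\<in>fin_paths (graph S). fin_rng p = src g \<and> n \<le> path_length p \<longrightarrow> restr_fin S g p \<in> nucleus S"
    using contracting_set_nucleus[OF contracting] assms(1) unfolding contracting_set_def by blast
  have "restr_list S g (stake k x) \<in> nucleus S" if "k \<ge> n" for k
    using bspec[OF n wf_digraph.stake_in_fin_paths(1)[OF graph assms(2), of k]] that assms(3)
    by (simp add: path_length_def restr_fin_def)
  then show ?thesis by (rule eventually_sequentiallyI)
qed

text \<open>Choose an edge into each vertex and iterate. The lemma serves to continue a finite
  strongly fixed path to a point of the boundary.\<close>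

lemma inf_path_exists:
  assumes "v \<in> verts E"
  obtains y where "y \<in> inf_paths E" "head E (shd y) = v"
proof -
  define f where "f v = (SOME e. e \<in> in_arcs E v)" for v
  have f: "f v \<in> arcs E" "head E (f v) = v" if "v \<in> verts E" for v
    using some_in_eq[of "in_arcs E v"] no_sources[OF that] by (auto simp: f_def)
  define y where "y = siterate (\<lambda>e. f (tail E e)) (f v)"
  have tail: "tail E e \<in> verts E" if "e \<in> arcs E" for e
    using wf_digraph.tail_in_verts[OF graph that] .
  have step: "y !! Suc i = f (tail E (y !! i))" for i
    unfolding y_def snth_siterate by simp
  have arc: "y !! i \<in> arcs E" for i
  proof (induction i)
    case 0
    show ?case using f(1)[OF assms] by (simp add: y_def)
  next
    case (Suc i)
    then show ?case unfolding step by (intro f(1) tail)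
  qed
  have "tail E (y !! i) = head E (y !! Suc i)" for i
    unfolding step using f(2)[OF tail[OF arc]] by simp
  moreover have "sset y \<subseteq> arcs E" using arc by (auto simp: sset_range)
  ultimately have "y \<in> inf_paths E" by (auto simp: inf_paths_def)
  moreover have "head E (shd y) = v" using f assms by (simp add: y_def)
  ultimately show ?thesis by (rule that)
qed

text \<open>If \<open>[\<alpha>, h, \<beta>; x]\<close> and \<open>[\<alpha>, g, \<beta>; x]\<close> are inseparable, then \<open>g\<close> and \<open>h\<close> agree on every prefix
  \<open>t\<close> of the path to which they apply, so that \<open>h|\<^sub>t = g|\<^sub>t n\<close> with \<open>n = (g\<^sup>-\<^sup>1h)|\<^sub>t\<close>. For long \<open>t\<close>, the
  element \<open>n\<close> lies in the nucleus.\<close>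

lemma inseparable_eventually:
  assumes r: "((v, a), g, (w, b), InfPath x) \<in> germ_reps S" and "z \<in> germs S"
    and insep: "inseparable (germ_topology S) (germ S (v, a) g (w, b) (InfPath x)) z"
  shows "\<forall>\<^sub>F k in sequentially. \<exists>n\<in>nucleus S. src n = fin_src E (w, stake k x) \<and> rng n = src n \<and>
    (let (\<alpha>, g') = germ_val S (v, a) g (w, b) (stake k x)
     in z = germ S \<alpha> (mult g' n) (w, stake k x) (InfPath x))"
proof -
  obtain v' a' h w' b' \<eta> where r': "((v', a'), h, (w', b'), \<eta>) \<in> germ_reps S"
      and z: "z = germ S (v', a') h (w', b') \<eta>"
    using assms(2) by (metis germs_cases prod.exhaust)
  have "\<eta> = InfPath x"
    using inseparable_germs_same_source insep r r' z by metis
  note r' = r'[unfolded this] and z = z[unfolded this]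
  have x: "x \<in> inf_paths E" "head E (shd x) = w" "stake (length b) x = b"
      "w' = w" "stake (length b') x = b'"
    using r r' by (auto simp: in_germ_reps_iff wf_digraph.is_prefix_iff[OF graph] ext_paths_def)
  \<comment> \<open>Long enough to pass both \<open>b\<close> and \<open>b'\<close>, so that the two
    germs can be rewritten over the common prefix \<open>p\<close>.\<close>
  define m where "m = max (length b) (length b')"
  define p where "p = stake m x"
  have "prefix b p" "prefix b' p"
    using prefix_stake[of "length b" m x] prefix_stake[of "length b'" m x] x
    by (auto simp: p_def m_def)
  then obtain q q' where q: "p = b @ q" "p = b' @ q'" unfolding prefix_def by blast
  define A where "A = a @ act_list S g q"
  define g1 where "g1 = restr_list S g q"
  define A' where "A' = a' @ act_list S h q'"
  define h1 where "h1 = restr_list S h q'"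
  have p: "edge_prefix p (InfPath x :: ('a, 'b) ext_path)" by (simp add: p_def)
  have r1: "((v, A), g1, (w, p), InfPath x) \<in> germ_reps S"
      "germ S (v, a) g (w, b) (InfPath x) = germ S (v, A) g1 (w, p) (InfPath x)"
    using germ_extend[OF r, of q, folded q(1), OF p] unfolding A_def g1_def by blast+
  have r2: "((v', A'), h1, (w, p), InfPath x) \<in> germ_reps S"
      "z = germ S (v', A') h1 (w, p) (InfPath x)"
    using germ_extend[OF r'[unfolded x(4)], of q', folded q(2), OF p]
    unfolding A'_def h1_def z x(4) by blast+
  have el: "g1 \<in> elems (gpd S)" "rng g1 = fin_src E (v, A)" "src g1 = fin_src E (w, p)"
      "h1 \<in> elems (gpd S)" "rng h1 = fin_src E (v', A')" "src h1 = fin_src E (w, p)"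
    using r1 r2 by (auto simp: in_germ_reps_iff)
  define t where "t k = stake (k - m) (sdrop m x)" for k
  have pt: "stake k x = p @ t k" if "k \<ge> m" for k
    using that by (simp add: p_def t_def stake_add)
  \<comment> \<open>The cylinder of the first \<open>k\<close> edges of \<open>x\<close> is a
    neighbourhood of \<open>x\<close>, hence contains a path \<open>\<zeta>\<close> over which the
    two germs coincide. A witness of that equality beyond these edges compares the actions on
    \<open>t k\<close>.\<close>
  have agree: "v = v' \<and> A = A' \<and> act_list S g1 (t k) = act_list S h1 (t k)" if k: "k \<ge> m" for k
  proof -
    have kx: "(w, stake k x) \<in> fin_paths E"
      using wf_digraph.stake_in_fin_paths(1)[OF graph x(1), of k] x by simp
    let ?V = "cylinder E (w, stake k x)"
    have V: "openin (path_topology E) ?V" "InfPath x \<in> ?V"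
      using kx x by (auto simp: wf_digraph.openin_cylinder[OF graph] wf_digraph.cylinder_iff[OF graph] ext_paths_def)
    obtain \<zeta> where zeta: "\<zeta> \<in> ?V" "((v, A), g1, (w, p), \<zeta>) \<in> germ_reps S"
        "((v', A'), h1, (w, p), \<zeta>) \<in> germ_reps S"
        "germ S (v, A) g1 (w, p) \<zeta> = germ S (v', A') h1 (w, p) \<zeta>"
      using inseparable_germs[OF insep[unfolded r1(2) r2(2)] r1(1) r2(1) V V] by metis
    have "edge_prefix (stake k x) \<zeta>"
      using zeta(1) kx by (simp add: wf_digraph.cylinder_iff[OF graph])
    then obtain P where P: "prefix (stake k x) P"
        "germ_val S (v, A) g1 (w, p) P = germ_val S (v', A') h1 (w, p) P"
      using germ_eq_above[OF zeta(2-4)] by metis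
    then obtain u where "P = p @ t k @ u" using pt[OF k] by (auto simp: prefix_def)
    with P(2) have "v = v'" "A @ act_list S g1 (t k @ u) = A' @ act_list S h1 (t k @ u)"
      by simp_all
    \<comment> \<open>The two acted-upon tails have equal length, so the concatenations split at the
      same place.\<close>
    moreover from this(2) have "A = A'" "act_list S g1 (t k @ u) = act_list S h1 (t k @ u)"
      by (simp_all add: append_eq_append_conv)
    moreover from this(2) have "act_list S g1 (t k) = act_list S h1 (t k)"
      by (simp add: act_list_append)
    ultimately show ?thesis by simp
  qed
  \<comment> \<open>At \<open>k = m\<close> the list \<open>t k\<close> is empty, and
    \<open>agree\<close> yields equality of \<open>(v, A)\<close> and \<open>(v', A')\<close>. Thus
    \<open>g1\<close> and \<open>h1\<close> have the same range and their quotient \<open>n0\<close>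
    exists.\<close>
  obtain n0 where n0: "n0 \<in> elems (gpd S)" "src n0 = src g1" "rng n0 = src g1"
      "\<And>es. \<lbrakk>(src g1, es) \<in> fin_paths E; act_list S g1 es = act_list S h1 es\<rbrakk> \<Longrightarrow>
       act_list S n0 es = es \<and> restr_list S h1 es = mult (restr_list S g1 es) (restr_list S n0 es)"
    using difference_element[of g1 h1] el agree[of m] by auto
  have sx: "sdrop m x \<in> inf_paths E" "head E (shd (sdrop m x)) = src n0"
    using wf_digraph.stake_in_fin_paths(2,3)[OF graph x(1), of m] x n0 el by (auto simp: p_def)
  \<comment> \<open>\<open>n0\<close> does not depend on \<open>k\<close>, so contraction applies to
    this one element and gives one threshold.\<close>
  obtain j where j: "\<And>k. k \<ge> j \<Longrightarrow> restr_list S n0 (stake k (sdrop m x)) \<in> nucleus S"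
    using eventually_restr_nucleus[OF n0(1) sx] by (auto simp: eventually_sequentially)
  show ?thesis
  proof (rule eventually_sequentiallyI)
    fix k assume k: "k \<ge> m + j"
    then have km: "k \<ge> m" by simp
    define n where "n = restr_list S n0 (t k)"
    have n: "n \<in> nucleus S" using j[of "k - m"] k by (simp add: n_def t_def)
    have "(src n0, t k) \<in> fin_paths E"
      using wf_digraph.stake_in_fin_paths(1)[OF graph sx(1), of "k - m"] sx(2) by (simp add: t_def)
    note tk = this n0(4)[of "t k"] agree[OF km] act_list_closed(3,4)[OF n0(1) this]
    have *: "act_list S n0 (t k) = t k" "restr_list S h1 (t k) = mult (restr_list S g1 (t k)) n"
      using tk(1-3) n0(2) by (auto simp: n_def)
    have "src n = fin_src E (w, stake k x)" "rng n = src n"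
      using tk(4,5) * n0 el by (simp_all add: n_def pt[OF km] fin_src_append)
    moreover have "z = germ S (v, A @ act_list S g1 (t k)) (mult (restr_list S g1 (t k)) n) (w, stake k x) (InfPath x)"
    proof -
      have "edge_prefix (p @ t k) (InfPath x :: ('a, 'b) ext_path)"
        using edge_prefix_stake[of k x] by (simp only: pt[OF km])
      from germ_extend(2)[OF r2(1) this] show ?thesis
        using tk(3) * r2(2) pt[OF km] by simp
    qed
    moreover have "germ_val S (v, a) g (w, b) (stake k x) = ((v, A @ act_list S g1 (t k)), restr_list S g1 (t k))"
      unfolding pt[OF km] q(1) append_assoc germ_val_append
      by (simp add: A_def g1_def act_list_append restr_list_append)
    ultimately show "\<exists>n\<in>nucleus S. src n = fin_src E (w, stake k x) \<and> rng n = src n \<and>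
        (let (\<alpha>, g') = germ_val S (v, a) g (w, b) (stake k x)
         in z = germ S \<alpha> (mult g' n) (w, stake k x) (InfPath x))"
      using n by (intro bexI[of _ n]) simp_all
  qed
qed

lemma finitely_non_Hausdorff_germ_topology: "finitely_non_Hausdorff (germ_topology S)"
  unfolding finitely_non_Hausdorff_def inseparable_def[symmetric] topspace_germ_topology
proof
  fix y assume "y \<in> germs S"
  then obtain v a g w b \<xi> where r: "((v, a), g, (w, b), \<xi>) \<in> germ_reps S" "y = germ S (v, a) g (w, b) \<xi>"
    by (metis germs_cases prod.exhaust)
  show "finite {z \<in> germs S. inseparable (germ_topology S) y z}" (is "finite ?Z")
  proof (cases \<xi>)
    case (FinPath p)
    then have "p \<in> fin_paths E"
      using r(1) by (auto simp: in_germ_reps_iff wf_digraph.is_prefix_iff[OF graph] ext_paths_def)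
    then have iso: "openin (path_topology E) {\<xi>}"
      using wf_digraph.openin_singleton_FinPath[OF graph, of "fst p" "snd p"] finite_in_arcs FinPath by simp
    \<comment> \<open>With the isolated point \<open>\<xi>\<close> as neighbourhood on both sides,
      the path over which the germs coincide can only be \<open>\<xi>\<close>.\<close>
    have "z = y" if z: "z \<in> germs S" "inseparable (germ_topology S) y z" for z
    proof -
      obtain \<gamma> h \<delta> \<eta> where r': "(\<gamma>, h, \<delta>, \<eta>) \<in> germ_reps S" "z = germ S \<gamma> h \<delta> \<eta>"
        using z(1) by (elim germs_cases)
      have "\<eta> = \<xi>" using inseparable_germs_same_source r r' z(2) by metis
      with inseparable_germs[OF z(2)[unfolded r(2) r'(2)] r(1) r'(1) iso _ iso] r(2) r'(2)
      show ?thesis by auto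
    qed
    then have "?Z \<subseteq> {y}" by blast
    then show ?thesis by (rule finite_subset) simp
  next
    case (InfPath x)
    \<comment> \<open>The germ recovered from \<open>y\<close> and \<open>n\<close> at level
      \<open>k\<close>. It does not refer to \<open>z\<close>, as the counting lemma
      requires.\<close>
    define f where "f k n = (let (\<alpha>, g') = germ_val S (v, a) g (w, b) (stake k x)
        in germ S \<alpha> (mult g' n) (w, stake k x) (InfPath x))" for k n
    have "\<forall>\<^sub>F k in sequentially. z \<in> f k ` nucleus S" if "z \<in> ?Z" for z
      using that inseparable_eventually[OF r(1)[unfolded InfPath], of z] r(2) InfPath
      by (auto simp: f_def split_beta Let_def image_iff elim!: eventually_mono)
    then show ?thesis
      using finite_card_le_if_eventually_image[OF finite_nucleus, of ?Z f] by blast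
  qed
qed

section \<open>The closure of the unit space\<close>

text \<open>A neighbourhood of \<open>c\<close> contains units over paths arbitrarily close to
  \<open>x\<close>, because a unit equal to a germ [\<alpha>, g, \<beta>; \<eta>] lies over \<eta>
  itself. Such units also enter any neighbourhood of the unit at \<open>x\<close>.\<close>

lemma Xbar_inseparable:
  assumes x: "x \<in> inf_paths E" and c: "c \<in> Xbar S (InfPath x)"
  shows "inseparable (germ_topology S) (germ_unit S (InfPath x)) c"
  unfolding inseparable_def
proof (rule notI, elim exE conjE)
  fix U V assume UV: "openin (germ_topology S) U" "openin (germ_topology S) V"
    "germ_unit S (InfPath x) \<in> U" "c \<in> V" "disjnt U V"
  have c': "c \<in> germs S" "germ_src S c = InfPath x"
      "c \<in> germ_topology S closure_of (germ_unit S ` boundary E)"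
    using c subsetD[OF closure_of_subtopology_subset]
    unfolding Xbar_def boundary_germs_def boundary_germ_topology_def by auto
  then obtain \<alpha> g \<beta> where r: "(\<alpha>, g, \<beta>, InfPath x) \<in> germ_reps S" "c = germ S \<alpha> g \<beta> (InfPath x)"
    by (metis germs_cases germ_src_germ)
  have x': "(InfPath x :: ('a, 'b) ext_path) \<in> ext_paths E" using x by (simp add: ext_paths_def)
  define w where "w = head E (shd x)"
  have u: "((w, []), w, (w, []), InfPath x) \<in> germ_reps S"
      "germ_unit S (InfPath x) = germ S (w, []) w (w, []) (InfPath x)"
    using germ_unit_eq[OF x' edge_prefix_Nil] by (auto simp: w_def)
  obtain U' where U': "openin (path_topology E) U'" "InfPath x \<in> U'"
      "\<And>\<eta>. \<lbrakk>\<eta> \<in> U'; is_prefix E (w, []) \<eta>\<rbrakk> \<Longrightarrow> germ S (w, []) w (w, []) \<eta> \<in> U"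
    using neighbourhood_germ[OF UV(1) u(1)] u(2) UV(3) by metis
  obtain V' where V': "openin (path_topology E) V'" "InfPath x \<in> V'"
      "\<And>\<eta>. \<lbrakk>\<eta> \<in> V'; is_prefix E \<beta> \<eta>\<rbrakk> \<Longrightarrow> germ S \<alpha> g \<beta> \<eta> \<in> V"
    using neighbourhood_germ[OF UV(2) r(1)] r(2) UV(4) by metis
  have w: "(w, []) \<in> fin_paths E" using u(1) by (simp add: in_germ_reps_iff)
  \<comment> \<open>The last factor forces the range \<open>w\<close>, so that the unit over a path
    of \<open>W\<close> is represented by the same vertex as the unit at \<open>x\<close>.\<close>
  define W where "W = U' \<inter> V' \<inter> cylinder E (w, [])"
  have W: "openin (path_topology E) W" "InfPath x \<in> W"
    using U' V' x' wf_digraph.openin_cylinder[OF graph w]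
    by (auto simp: W_def wf_digraph.cylinder_iff[OF graph w] w_def[symmetric])
  define B where "B = {germ S \<alpha> g \<beta> \<eta> | \<eta>. \<eta> \<in> W \<and> is_prefix E \<beta> \<eta>}"
  have "openin (germ_topology S) B" "c \<in> B"
    using openin_germs[OF r(1) W(1)] W(2) r by (auto simp: B_def in_germ_reps_iff)
  then obtain \<theta> where t: "\<theta> \<in> boundary E" "germ_unit S \<theta> \<in> B"
    using c'(3) unfolding in_closure_of by blast
  then obtain \<eta> where e: "\<eta> \<in> W" "is_prefix E \<beta> \<eta>" "germ_unit S \<theta> = germ S \<alpha> g \<beta> \<eta>"
    unfolding B_def by blast
  have "\<theta> \<in> ext_paths E" using t(1) by (auto simp: boundary_def ext_paths_def)
  note unit = germ_unit_eq[OF this edge_prefix_Nil]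
  have "(\<alpha>, g, \<beta>, \<eta>) \<in> germ_reps S" using r(1) e(2) by (simp add: in_germ_reps_iff)
  from germ_eq_iff[OF unit(1) this] unit(2) e(3) have "\<theta> = \<eta>" by simp
  have "ext_rng E \<eta> = w" "is_prefix E (w, []) \<eta>"
    using e(1) w by (auto simp: W_def is_prefix_def wf_digraph.cylinder_iff[OF graph w])
  then have "germ_unit S \<theta> \<in> U"
    using U'(3)[of \<eta>] e(1) \<open>\<theta> = \<eta>\<close> by (simp add: germ_unit_def W_def)
  moreover have "germ_unit S \<theta> \<in> V" using e V'(3)[of \<eta>] by (simp add: W_def)
  ultimately show False using UV(5) by (auto simp: disjnt_iff)
qed

text \<open>Apply \<open>inseparable_eventually\<close> to the unit, whose value at a prefix
  consists of that prefix and its source vertex; multiplying n by this vertex leaves n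
  unchanged.\<close>

lemma Xbar_eventually:
  assumes x: "x \<in> inf_paths E" and c: "c \<in> Xbar S (InfPath x)"
  defines "w \<equiv> head E (shd x)"
  shows "\<forall>\<^sub>F k in sequentially. \<exists>n\<in>nucleus S. src n = fin_src E (w, stake k x) \<and> rng n = src n \<and>
    c = germ S (w, stake k x) n (w, stake k x) (InfPath x)"
proof -
  have x': "(InfPath x :: ('a, 'b) ext_path) \<in> ext_paths E" using x by (simp add: ext_paths_def)
  have u: "((w, []), w, (w, []), InfPath x) \<in> germ_reps S"
      "germ_unit S (InfPath x) = germ S (w, []) w (w, []) (InfPath x)"
    using germ_unit_eq[OF x' edge_prefix_Nil] by (auto simp: w_def)
  have c': "c \<in> germs S" using c by (simp add: Xbar_def boundary_germs_def)
  have val: "germ_val S (w, []) w (w, []) (stake k x) = ((w, stake k x), fin_src E (w, stake k x))" for k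
    using list_unit[OF wf_digraph.stake_in_fin_paths(1)[OF graph x, of k]]
    by (simp add: germ_val_def Let_def w_def)
  show ?thesis
    using inseparable_eventually[OF u(1) c' Xbar_inseparable[OF x c, unfolded u(2)]]
  proof (rule eventually_mono, elim bexE conjE, intro bexI conjI)
    fix k n assume n: "n \<in> nucleus S" "src n = fin_src E (w, stake k x)" "rng n = src n"
      and "let (\<alpha>, g') = germ_val S (w, []) w (w, []) (stake k x)
        in c = germ S \<alpha> (mult g' n) (w, stake k x) (InfPath x)"
    then have "c = germ S (w, stake k x) (mult (rng n) n) (w, stake k x) (InfPath x)"
      by (simp add: val)
    moreover have "mult (rng n) n = n"
      using groupoid.rng_mult_id[OF groupoid] nucleus_subset n(1) by blast
    ultimately show "c = germ S (w, stake k x) n (w, stake k x) (InfPath x)" by simp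
  qed
qed

text \<open>After \<open>q\<close> the restriction of g is a vertex, which acts trivially on
  whatever follows.\<close>

lemma strongly_fixed_fin_append:
  assumes "strongly_fixed_fin S g (u, q)" "(u, q @ q') \<in> fin_paths E"
  shows "strongly_fixed_fin S g (u, q @ q')"
proof -
  have q: "u = src g" "rng g = u" "act_list S g q = q" "restr_list S g q = fin_src E (u, q)"
    using assms(1) by (auto simp: strongly_fixed_fin_def act_fin_def restr_fin_def)
  have "(fin_src E (u, q), q') \<in> fin_paths E"
    using assms(2) by (simp add: wf_digraph.append_in_fin_paths[OF graph])
  from list_unit[OF this] q assms(2) show ?thesis
    by (simp add: strongly_fixed_fin_def act_fin_def restr_fin_def act_list_append
        restr_list_append fin_src_append)
qed

text \<open>By \<open>germ_eq_unit_iff\<close>, a strongly fixed prefix of the remaining path would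
  make the germ a unit. For a prefix \<open>l\<close> of the remaining path, inseparability gives a
  path through \<open>p @ l\<close> over which the germ is a unit, and with it a strongly fixed
  \<open>q\<close> comparable with \<open>l\<close>.\<close>

lemma singular_decomposition_if_inseparable:
  assumes r: "((w, p), n, (w, p), InfPath x) \<in> germ_reps S"
    and insep: "inseparable (germ_topology S) (germ_unit S (InfPath x)) (germ S (w, p) n (w, p) (InfPath x))"
    and neq: "germ S (w, p) n (w, p) (InfPath x) \<noteq> germ_unit S (InfPath x)"
  shows "singular_decomposition S (InfPath x) (w, p) n"
proof -
  have x: "(w, p) \<in> fin_paths E" "n \<in> elems (gpd S)" "rng n = fin_src E (w, p)" "src n = fin_src E (w, p)"
      "x \<in> inf_paths E" "head E (shd x) = w" "stake (length p) x = p"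
    using r by (auto simp: in_germ_reps_iff wf_digraph.is_prefix_iff[OF graph] ext_paths_def)
  define \<xi> where "\<xi> = sdrop (length p) x"
  have px: "x = p @- \<xi>" using x(7) stake_sdrop[of "length p" x] by (simp add: \<xi>_def)
  have \<xi>: "\<xi> \<in> inf_paths E" "head E (shd \<xi>) = src n"
    using wf_digraph.stake_in_fin_paths(2,3)[OF graph x(5), of "length p"] x by (auto simp: \<xi>_def)
  have x': "(InfPath x :: ('a, 'b) ext_path) \<in> ext_paths E" using x by (simp add: ext_paths_def)
  have pl: "edge_prefix (p @ l) (InfPath x :: ('a, 'b) ext_path) \<longleftrightarrow> edge_prefix l (InfPath \<xi> :: ('a, 'b) ext_path)" for l
    unfolding px by (rule edge_prefix_shift)
  have "\<not> strongly_fixed_inf S n \<xi>"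
  proof
    assume "strongly_fixed_inf S n \<xi>"
    then obtain u l where l: "is_prefix E (u, l) (InfPath \<xi>)" "strongly_fixed_fin S n (u, l)"
      unfolding strongly_fixed_inf_def by (metis prod.exhaust)
    then have "edge_prefix (p @ l) (InfPath x :: ('a, 'b) ext_path)" "u = src n"
      using pl \<xi> by (auto simp: wf_digraph.is_prefix_iff[OF graph])
    with l neq germ_eq_unit_iff[OF r] show False by blast
  qed
  moreover have "\<exists>\<gamma>. is_prefix E \<beta> (FinPath \<gamma>) \<and> strongly_fixed_fin S n \<gamma>"
    if "is_prefix E \<beta> (InfPath \<xi>)" for \<beta>
  proof -
    obtain u l where b: "\<beta> = (u, l)" by (metis prod.exhaust)
    have l: "u = src n" "edge_prefix l (InfPath \<xi> :: ('a, 'b) ext_path)"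
      using that \<xi> by (auto simp: b wf_digraph.is_prefix_iff[OF graph])
    then have pl': "edge_prefix (p @ l) (InfPath x :: ('a, 'b) ext_path)" using pl by blast
    have wpl: "(w, p @ l) \<in> fin_paths E"
      using wf_digraph.edge_prefix_in_fin_paths[OF graph x' pl'] x by simp
    have V: "openin (path_topology E) (cylinder E (w, p @ l))" "InfPath x \<in> cylinder E (w, p @ l)"
      using wpl x x' pl' wf_digraph.openin_cylinder[OF graph]
      by (auto simp: wf_digraph.cylinder_iff[OF graph])
    have u: "((w, p), fin_src E (w, p), (w, p), InfPath x) \<in> germ_reps S"
        "germ_unit S (InfPath x) = germ S (w, p) (fin_src E (w, p)) (w, p) (InfPath x)"
      using germ_unit_eq[OF x', of p] x by auto
    obtain \<zeta> where z: "\<zeta> \<in> cylinder E (w, p @ l)" "((w, p), n, (w, p), \<zeta>) \<in> germ_reps S"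
        "germ S (w, p) (fin_src E (w, p)) (w, p) \<zeta> = germ S (w, p) n (w, p) \<zeta>"
      using inseparable_germs[OF insep[unfolded u(2)] u(1) r V V] by metis
    have z': "\<zeta> \<in> ext_paths E" "ext_rng E \<zeta> = w" "edge_prefix (p @ l) \<zeta>"
      using z(1) by (auto simp: wf_digraph.cylinder_iff[OF graph wpl])
    moreover from this have "edge_prefix p \<zeta>" by (auto intro: edge_prefix_mono)
    ultimately have "germ S (w, p) n (w, p) \<zeta> = germ_unit S \<zeta>"
      using germ_unit_eq(2)[of \<zeta> p] z(3) by simp
    then obtain q where q: "edge_prefix (p @ q) \<zeta>" "strongly_fixed_fin S n (src n, q)"
      using germ_eq_unit_iff[OF z(2)] by blast
    have "prefix l q \<or> prefix q l"
      using edge_prefix_linear[OF z'(3) q(1)] by simp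
    then show ?thesis
    proof
      assume "prefix l q"
      moreover have "(src n, q) \<in> fin_paths E" using q(2) by (simp add: strongly_fixed_fin_def)
      ultimately have "is_prefix E \<beta> (FinPath (src n, q))"
        using l by (simp add: b wf_digraph.is_prefix_iff[OF graph] ext_paths_def)
      with q(2) show ?thesis by blast
    next
      \<comment> \<open>If \<open>q\<close> is too short to extend \<open>l\<close>, then
        \<open>l\<close> inherits strong fixedness from it and is its own extension.\<close>
      assume "prefix q l"
      have sl: "(src n, l) \<in> fin_paths E"
        using that l b by (simp add: is_prefix_def)
      then have "strongly_fixed_fin S n (src n, l)"
        using \<open>prefix q l\<close> strongly_fixed_fin_append[OF q(2)] by (auto simp: prefix_def)
      moreover have "is_prefix E \<beta> (FinPath (src n, l))"
        using l sl by (simp add: b wf_digraph.is_prefix_iff[OF graph] ext_paths_def)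
      ultimately show ?thesis by blast
    qed
  qed
  ultimately show ?thesis
    using x \<xi> px unfolding singular_decomposition_def by (intro conjI bexI[of _ \<xi>]) auto
qed

lemma fixed_germ_in_boundary_germs:
  assumes "((w, p), n, (w, p), InfPath (p @- \<xi>)) \<in> germ_reps S" "act_stream S n \<xi> = \<xi>"
  defines "c \<equiv> germ S (w, p) n (w, p) (InfPath (p @- \<xi>))"
  shows "c \<in> boundary_germs S" "germ_rng S c = InfPath (p @- \<xi>)" "germ_src S c = InfPath (p @- \<xi>)"
proof -
  show 1: "germ_rng S c = InfPath (p @- \<xi>)" "germ_src S c = InfPath (p @- \<xi>)"
    unfolding c_def using germ_rng_germ[OF assms(1)] germ_src_germ[OF assms(1)] assms(2) by simp_all
  have "InfPath (p @- \<xi>) \<in> boundary E"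
    using assms(1) unfolding boundary_eq
    by (auto simp: in_germ_reps_iff wf_digraph.is_prefix_iff[OF graph] ext_paths_def)
  then show "c \<in> boundary_germs S"
    using 1 germ_in_germs[OF assms(1)] by (simp add: boundary_germs_def c_def)
qed

lemma unit_in_boundary_germs:
  assumes x: "x \<in> inf_paths E"
  shows "germ_unit S (InfPath x) \<in> boundary_germs S"
    "germ_rng S (germ_unit S (InfPath x)) = InfPath x"
    "germ_src S (germ_unit S (InfPath x)) = InfPath x"
proof -
  have x': "(InfPath x :: ('a, 'b) ext_path) \<in> ext_paths E" using x by (simp add: ext_paths_def)
  define w where "w = head E (shd x)"
  have u: "((w, []), w, (w, []), InfPath ([] @- x)) \<in> germ_reps S"
      "germ_unit S (InfPath x) = germ S (w, []) w (w, []) (InfPath ([] @- x))"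
    using germ_unit_eq[OF x' edge_prefix_Nil] by (auto simp: w_def)
  have "act_stream S w x = x"
    using list_unit(1)[OF wf_digraph.stake_in_fin_paths(1)[OF graph x]]
    by (intro stream_eqI_stake) (simp add: stake_act_stream w_def)
  from fixed_germ_in_boundary_germs[OF u(1) this, folded u(2)]
  show "germ_unit S (InfPath x) \<in> boundary_germs S"
    "germ_rng S (germ_unit S (InfPath x)) = InfPath x"
    "germ_src S (germ_unit S (InfPath x)) = InfPath x" by simp_all
qed

lemma unit_in_Xbar:
  assumes "x \<in> inf_paths E"
  shows "germ_unit S (InfPath x) \<in> Xbar S (InfPath x)"
proof -
  have "germ_unit S (InfPath x) \<in> topspace (boundary_germ_topology S) \<inter> germ_unit S ` boundary E"
    using unit_in_boundary_germs[OF assms] assms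
    by (auto simp: boundary_germ_topology_def topspace_germ_topology boundary_germs_def boundary_eq)
  then have "germ_unit S (InfPath x) \<in> boundary_germ_topology S closure_of (germ_unit S ` boundary E)"
    by (rule subsetD[OF closure_of_subset_Int])
  with unit_in_boundary_germs[OF assms] show ?thesis by (simp add: Xbar_def)
qed

text \<open>Close to \<open>x\<close>, replace the path after \<open>p\<close> by a strongly fixed
  extension of a long prefix of \<xi>, continued to infinity. Over the resulting path the germ is a
  unit.\<close>

lemma singular_decomposition_in_Xbar:
  assumes "singular_decomposition S (InfPath x) (w, p) n" "is_prefix E (w, p) (InfPath x)"
  shows "germ S (w, p) n (w, p) (InfPath x) \<in> Xbar S (InfPath x)"
proof -
  obtain \<xi> where n: "n \<in> elems (gpd S)" "fin_src E (w, p) = rng n" and \<xi>: "\<xi> \<in> inf_paths E"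
      "head E (shd \<xi>) = rng n" "x = p @- \<xi>"
      and fixed: "\<And>\<beta>. is_prefix E \<beta> (InfPath \<xi>) \<Longrightarrow>
        \<exists>\<gamma>. is_prefix E \<beta> (FinPath \<gamma>) \<and> strongly_fixed_fin S n \<gamma>"
    using assms(1) unfolding singular_decomposition_def by auto
  have fixed_stake: "\<exists>l. prefix (stake k \<xi>) l \<and> strongly_fixed_fin S n (rng n, l)" for k
  proof -
    have "is_prefix E (rng n, stake k \<xi>) (InfPath \<xi>)"
      using \<xi> by (simp add: wf_digraph.is_prefix_iff[OF graph] ext_paths_def)
    then obtain u l where "is_prefix E (rng n, stake k \<xi>) (FinPath (u, l))" "strongly_fixed_fin S n (u, l)"
      using fixed by (metis prod.exhaust)
    then show ?thesis by (auto simp: wf_digraph.is_prefix_iff[OF graph])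
  qed
  \<comment> \<open>A singular decomposition fixes only the range of \<open>n\<close>. That the
    source agrees follows from the strongly fixed extension of the empty prefix.\<close>
  have n': "src n = rng n" using fixed_stake[of 0] by (auto simp: strongly_fixed_fin_def)
  have r: "((w, p), n, (w, p), \<eta>) \<in> germ_reps S" if "is_prefix E (w, p) \<eta>" for \<eta>
    using that n n' by (auto simp: in_germ_reps_iff is_prefix_def)
  \<comment> \<open>Every prefix of \<xi> is fixed as part of a fixed longer path; hence the range
    of the germ is again \<open>x\<close>.\<close>
  have "act_stream S n \<xi> = \<xi>"
  proof (rule stream_eqI_stake)
    fix k
    obtain l where "prefix (stake k \<xi>) l" "act_list S n l = l"
      using fixed_stake[of k] by (auto simp: strongly_fixed_fin_def act_fin_def)
    then show "stake k (act_stream S n \<xi>) = stake k \<xi>"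
      by (auto simp: prefix_def act_list_append stake_act_stream)
  qed
  note c = fixed_germ_in_boundary_germs[OF r[OF assms(2), unfolded \<xi>(3)] this, folded \<xi>(3)]
  have "germ S (w, p) n (w, p) (InfPath x) \<in>
      germ_topology S closure_of (boundary_germs S \<inter> germ_unit S ` boundary E)"
    unfolding in_closure_of
  proof (intro conjI allI impI)
    show "germ S (w, p) n (w, p) (InfPath x) \<in> topspace (germ_topology S)"
      using germ_in_germs[OF r[OF assms(2)]] by (simp add: topspace_germ_topology)
    fix T assume "germ S (w, p) n (w, p) (InfPath x) \<in> T \<and> openin (germ_topology S) T"
    then have T: "germ S (w, p) n (w, p) (InfPath x) \<in> T" "openin (germ_topology S) T" by auto
    obtain V where V: "openin (path_topology E) V" "InfPath x \<in> V"
        "\<And>\<eta>. \<lbrakk>\<eta> \<in> V; is_prefix E (w, p) \<eta>\<rbrakk> \<Longrightarrow> germ S (w, p) n (w, p) \<eta> \<in> T"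
      using neighbourhood_germ[OF T(2) r[OF assms(2)] T(1)] by metis
    obtain k where k: "cylinder E (head E (shd x), stake k x) \<subseteq> V"
      using wf_digraph.neighbourhood_InfPath[OF graph V(1,2)] by metis
    have x: "x \<in> inf_paths E" "head E (shd x) = w" "(w, p) \<in> fin_paths E"
      using assms(2) wf_digraph.is_prefix_in_fin_paths[OF graph assms(2)]
      by (auto simp: wf_digraph.is_prefix_iff[OF graph] ext_paths_def)
    obtain l where l: "prefix (stake k \<xi>) l" "strongly_fixed_fin S n (rng n, l)"
      using fixed_stake by blast
    then have pl: "(w, p @ l) \<in> fin_paths E"
      using x n by (auto simp: strongly_fixed_fin_def wf_digraph.append_in_fin_paths[OF graph])
    obtain y where y: "y \<in> inf_paths E" "head E (shd y) = fin_src E (w, p @ l)"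
      using inf_path_exists[OF wf_digraph.fin_src_in_verts[OF graph pl]] by metis
    define \<eta> :: "('a, 'b) ext_path" where "\<eta> = InfPath ((p @ l) @- y)"
    have py: "(p @ l) @- y \<in> inf_paths E" "head E (shd ((p @ l) @- y)) = w"
      using wf_digraph.shift_in_inf_paths[OF graph, of "p @ l" y w] pl y by blast+
    have \<eta>: "\<eta> \<in> ext_paths E" "ext_rng E \<eta> = w" "edge_prefix (p @ l) \<eta>"
      using py edge_prefix_shift[of "p @ l" "[]" y] unfolding \<eta>_def by (auto simp: ext_paths_def)
    have "stake (length p + k) x = p @ stake k \<xi>"
      by (simp add: \<xi>(3) stake_add[symmetric] stake_shift sdrop_shift)
    then have "prefix (stake k x) (p @ l)"
      using prefix_stake[of k "length p + k" x] l(1) by (metis le_add2 prefix_order.trans same_prefix_prefix)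
    then have "is_prefix E (w, stake k x) \<eta>" "is_prefix E (w, p) \<eta>"
      using \<eta> edge_prefix_mono[OF \<eta>(3)] by (simp_all add: wf_digraph.is_prefix_iff[OF graph])
    then have "germ S (w, p) n (w, p) \<eta> \<in> T"
      using V(3)[of \<eta>] k x(2) by (auto simp: is_prefix_def)
    moreover have "germ S (w, p) n (w, p) \<eta> = germ_unit S \<eta>"
      using germ_eq_unit_iff[OF r[OF \<open>is_prefix E (w, p) \<eta>\<close>]] \<eta>(3) l(2) n' by auto
    moreover have "germ_unit S \<eta> \<in> boundary_germs S \<inter> germ_unit S ` boundary E"
      using unit_in_boundary_germs[OF py(1)] py(1) by (auto simp: \<eta>_def boundary_eq)
    ultimately show "\<exists>y. y \<in> boundary_germs S \<inter> germ_unit S ` boundary E \<and> y \<in> T" by auto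
  qed
  with c show ?thesis
    unfolding Xbar_def boundary_germ_topology_def closure_of_subtopology by simp
qed

text \<open>Precedes the formula for \<open>Xbar\<close>, whose uniform length rests on this
  finiteness. All elements are counted through the nucleus, the unit included.\<close>

lemma finite_Xbar:
  assumes "x \<in> inf_paths E"
  shows "finite (Xbar S (InfPath x)) \<and> card (Xbar S (InfPath x)) \<le> card (nucleus S)"
proof (rule finite_card_le_if_eventually_image[OF finite_nucleus])
  fix c assume "c \<in> Xbar S (InfPath x)"
  from Xbar_eventually[OF assms this]
  show "\<forall>\<^sub>F k in sequentially. c \<in>
      (\<lambda>n. germ S (head E (shd x), stake k x) n (head E (shd x), stake k x) (InfPath x)) ` nucleus S"
    by (rule eventually_mono) blast
qed

text \<open>The length of \<alpha> serves the inclusion from left to right: it makes every element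
  of \<open>Xbar\<close> a germ [\<alpha>, n, \<alpha>; x] with n in the nucleus, which is then
  either the unit or comes from a singular decomposition.\<close>

lemma Xbar_eq:
  assumes x: "x \<in> inf_paths E"
  shows "\<exists>n\<^sub>0. \<forall>\<alpha>. is_prefix E \<alpha> (InfPath x) \<and> n\<^sub>0 \<le> path_length \<alpha> \<longrightarrow>
    Xbar S (InfPath x) = {germ_unit S (InfPath x)} \<union>
      {germ S \<alpha> n \<alpha> (InfPath x) | n. n \<in> nucleus S \<and> singular_decomposition S (InfPath x) \<alpha> n}"
proof -
  define w where "w = head E (shd x)"
  have "\<forall>\<^sub>F k in sequentially. \<forall>c\<in>Xbar S (InfPath x). \<exists>n\<in>nucleus S. src n = fin_src E (w, stake k x) \<and>
      rng n = src n \<and> c = germ S (w, stake k x) n (w, stake k x) (InfPath x)"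
    unfolding w_def using finite_Xbar[OF x] Xbar_eventually[OF x] by (intro eventually_ball_finite) auto
  then obtain n\<^sub>0 where n0: "\<And>k c. \<lbrakk>k \<ge> n\<^sub>0; c \<in> Xbar S (InfPath x)\<rbrakk> \<Longrightarrow>
      \<exists>n\<in>nucleus S. src n = fin_src E (w, stake k x) \<and> rng n = src n \<and>
        c = germ S (w, stake k x) n (w, stake k x) (InfPath x)"
    unfolding eventually_sequentially by blast
  show ?thesis
  proof (intro exI[of _ n\<^sub>0] allI impI, elim conjE)
    fix \<alpha> assume \<alpha>: "is_prefix E \<alpha> (InfPath x)" "n\<^sub>0 \<le> path_length \<alpha>"
    define p where "p = snd \<alpha>"
    have p: "\<alpha> = (w, p)" "p = stake (length p) x" "(w, p) \<in> fin_paths E"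
      using \<alpha>(1) wf_digraph.is_prefix_in_fin_paths[OF graph \<alpha>(1)]
      by (cases \<alpha>; auto simp: p_def w_def wf_digraph.is_prefix_iff[OF graph])+
    have "length p \<ge> n\<^sub>0" using \<alpha>(2) by (simp add: path_length_def p_def)
    note n0 = n0[OF this, folded p(2)]
    have "c = germ_unit S (InfPath x) \<or> (\<exists>n\<in>nucleus S. singular_decomposition S (InfPath x) \<alpha> n \<and>
        c = germ S \<alpha> n \<alpha> (InfPath x))" if c: "c \<in> Xbar S (InfPath x)" for c
    proof -
      obtain n where n: "n \<in> nucleus S" "src n = fin_src E (w, p)" "rng n = src n"
          "c = germ S (w, p) n (w, p) (InfPath x)"
        using n0[OF c] by blast
      then have "((w, p), n, (w, p), InfPath x) \<in> germ_reps S"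
        using \<alpha>(1) p(1,3) nucleus_subset by (auto simp: in_germ_reps_iff)
      from singular_decomposition_if_inseparable[OF this Xbar_inseparable[OF x c, unfolded n(4)]] n p(1)
      show ?thesis by blast
    qed
    moreover have "germ S \<alpha> n \<alpha> (InfPath x) \<in> Xbar S (InfPath x)"
      if "singular_decomposition S (InfPath x) \<alpha> n" for n
      using singular_decomposition_in_Xbar that \<alpha>(1) unfolding p(1) by blast
    ultimately show "Xbar S (InfPath x) = {germ_unit S (InfPath x)} \<union>
      {germ S \<alpha> n \<alpha> (InfPath x) | n. n \<in> nucleus S \<and> singular_decomposition S (InfPath x) \<alpha> n}"
      using unit_in_Xbar[OF x] by blast
  qed
qed

end

theorem corollary6p23:
  fixes S :: "('g, 'e) action_struct"
  assumes "contracting_action S"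
  shows "boundary (graph S) = InfPath ` inf_paths (graph S)
    \<and> (\<forall>\<mu>\<in>boundary (graph S).
        (\<exists>n\<^sub>0. \<forall>\<alpha>. is_prefix (graph S) \<alpha> \<mu> \<and> n\<^sub>0 \<le> path_length \<alpha> \<longrightarrow>
           Xbar S \<mu> = {germ_unit S \<mu>} \<union>
             {germ S \<alpha> n \<alpha> \<mu> | n. n \<in> nucleus S \<and> singular_decomposition S \<mu> \<alpha> n})
        \<and> finite (Xbar S \<mu>) \<and> card (Xbar S \<mu>) \<le> card (nucleus S))
    \<and> finitely_non_Hausdorff (germ_topology S)
    \<and> finitely_non_Hausdorff (boundary_germ_topology S)"
proof -
  interpret contracting_action S by (rule assms)
  have "(\<exists>n\<^sub>0. \<forall>\<alpha>. is_prefix (graph S) \<alpha> \<mu> \<and> n\<^sub>0 \<le> path_length \<alpha> \<longrightarrow>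
           Xbar S \<mu> = {germ_unit S \<mu>} \<union>
             {germ S \<alpha> n \<alpha> \<mu> | n. n \<in> nucleus S \<and> singular_decomposition S \<mu> \<alpha> n})
        \<and> finite (Xbar S \<mu>) \<and> card (Xbar S \<mu>) \<le> card (nucleus S)"
    if mu: "\<mu> \<in> boundary (graph S)" for \<mu>
  proof -
    obtain x where x: "x \<in> inf_paths (graph S)" and \<mu>: "\<mu> = InfPath x"
      using mu unfolding boundary_eq by blast
    show ?thesis unfolding \<mu> using Xbar_eq[OF x] finite_Xbar[OF x] by (rule conjI)
  qed
  moreover have "finitely_non_Hausdorff (boundary_germ_topology S)"
    unfolding boundary_germ_topology_def
    by (rule finitely_non_Hausdorff_subtopology[OF finitely_non_Hausdorff_germ_topology])
  ultimately show ?thesis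
    using boundary_eq finitely_non_Hausdorff_germ_topology by blast
qed

end
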